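(* Let $\{\mathbb{P}_n\}_n$ be a family of polynomials orthogonal with respect to a classical weight function $\rho$ on a simply connected open subset $\Omega$ of $\mathbb{R}^2$, and let $\Phi$, $\psi_1$, $\psi_2$ be the matrix polynomial and polynomials associated with $\rho$ by the definition of a classical weight. Let $v$ be the moment functional defined by $$\langle v,p\rangle=\int_\Omega p\,\rho\,dxdy,\qquad p\in\mathcal{P}.$$ Then $\{\mathbb{P}_n\}_n$ is orthogonal with respect to $v$, $v$ satisfies the Pearson-type equation $\mathrm{div}(\Phi v)=(\psi_1,\psi_2)v$, and $\det\langle v,\Phi\rangle\neq0$.
   Context: Notation. $\mathcal{P}=\mathbb{R}[x,y]$; $\mathcal{P}_n$ is the space of polynomials of total degree at most $n$; $\mathcal{M}_{h,k}(\cdot)$ denotes $h\times k$ matrices. $X=(x,y)^t$, $X_0=1$, $X_n=(x^n,x^{n-1}y,\dots,y^n)^t$. $\nabla A=\begin{pmatrix}\partial_xA\\ \partial_yA\end{pmatrix}$, $\mathrm{div}\begin{pmatrix}A\\ B\end{pmatrix}=\partial_xA+\partial_yB$, $\begin{pmatrix}A\\ B\end{pmatrix}\cdot\overrightarrow{n}=An_x+Bn_y$; so $\nabla(f,g)=\begin{pmatrix}\partial_xf&\partial_xg\\ \partial_yf&\partial_yg\end{pmatrix}$. A weight function on $\Omega$ is a non-negative integrable function on $\Omega$. A family $\mathbb{P}_n=(P_{n,0},P_{n-1,1},\dots,P_{0,n})^t$, $n\ge0$, of $(n+1)$-vectors of polynomials of degree $n$ linearly independent modulo $\mathcal{P}_{n-1}$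 is orthogonal with respect to $\rho$ if $\int_\Omega X_m\mathbb{P}_n^t\rho\,dxdy=0$ for $m<n$ and $\int_\Omega X_n\mathbb{P}_n^t\rho\,dxdy$ is invertible. A weight function $\rho$ on $\Omega$ is classical if there exist a symmetric, positive definite $2\times2$ matrix polynomial $\Phi=(\phi_{i,j})$ of total degree at most 2 such that (i) $\lim_{j\to\infty}1_{\partial\Omega_j}(\rho\Phi\nabla u)\cdot\overrightarrow{n_j}=0$ for all $n\ge 1$ and $u\in\mathcal{M}_{1,n}(\mathcal{P})$, where $\Omega_j=\Omega\cap B(O,j)$, $B(O,j)$ is the open ball of radius $j$ centred at the origin, $\overrightarrow{n_j}$ is the outer normal of $\partial\Omega_j$ and $1_S$ is the indicator function of $S$ (limit of a sequence of functions, boundary values understood as limits from inside); (ii) $\phi_{1,1}\partial_x\Phi+\phi_{2,1}\partial_y\Phi=\Phi\nabla(\phi_{1,1},\phi_{2,1})$ and $\phi_{1,2}\partial_x\Phi+\phi_{2,2}\partial_y\Phi=\Phi\nabla(\phi_{1,2},\phi_{2,2})$; and two polynomials $\psi_i(x,y)=X^tD_i+E_i$, $i=1,2$, of total degree 1 ($D_i\in\mathbb{R}^2$, $E_i\in\mathbb{R}$) with $\det(D_1,D_2)\ne0$ and $\mathrm{div}(\rho\Phi)=\rho(\psi_1,\psi_2)$. Moment functionals: a moment functional $w$ is a linear functional on $\mathcal{P}$; it acts entrywise on matrix polynomials. For $q\in\mathcal{P}$, $\langle qw,p\rangle=\langle w,qp\rangle$; $\langle\partial_xw,p\rangle=-\langle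 w,\partial_xp\rangle$, $\langle\partial_yw,p\rangle=-\langle w,\partial_yp\rangle$. $\mathrm{div}(\Phi v)=(\partial_x(\phi_{1,1}v)+\partial_y(\phi_{2,1}v),\ \partial_x(\phi_{1,2}v)+\partial_y(\phi_{2,2}v))$ and $(\psi_1,\psi_2)v=(\psi_1v,\psi_2v)$. $\{\mathbb{P}_n\}_n$ is orthogonal with respect to $v$ if $\langle v,\mathbb{P}_m\mathbb{P}_n^t\rangle=0$ for $m\ne n$ and $\langle v,\mathbb{P}_n\mathbb{P}_n^t\rangle$ is invertible for every $n$.
   Formalization: Added assumption: the boundary points of Ω at which an outer normal exists are dense in the boundary of Ω; without it (e.g. on a snowflake domain) the outer normal in condition (i) is undefined. *)

theory Defs
  imports
    "HOL-Analysis.Analysis"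
    "Jordan_Normal_Form.Matrix"
    "Jordan_Normal_Form.Determinant"
begin

section \<open>Bivariate real polynomials\<close>

text \<open>The ring of real polynomials in \<open>x\<close> and \<open>y\<close> is represented as \<open>(\<real>[x])[y]\<close>: the outer variable
  is \<open>y\<close>, and \<open>coeff (coeff p j) i\<close> is the coefficient of \<open>x\<^sup>i y\<^sup>j\<close>. The plane is \<open>real \<times> real\<close>.\<close>

type_synonym bipoly = "real poly poly"

definition const :: "real \<Rightarrow> bipoly" where "const c = [:[:c:]:]"

definition varx :: bipoly where "varx = [:[:0, 1:]:]"

definition vary :: bipoly where "vary = [:0, 1:]"

definition eval :: "bipoly \<Rightarrow> real \<times> real \<Rightarrow> real" where
  "eval p z = poly (poly p [:snd z:]) (fst z)"

definition dx :: "bipoly \<Rightarrow> bipoly" where "dx = map_poly pderiv"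

definition dy :: "bipoly \<Rightarrow> bipoly" where "dy = pderiv"

definition poly_deg_le :: "nat \<Rightarrow> bipoly set" where
  "poly_deg_le n = {p. \<forall>i j. coeff (coeff p j) i \<noteq> 0 \<longrightarrow> i + j \<le> n}"

text \<open>The strict version makes the space of polynomials of degree at most \<open>n - 1\<close> equal to \<open>{0}\<close>
  for \<open>n = 0\<close>.\<close>

definition poly_deg_less :: "nat \<Rightarrow> bipoly set" where
  "poly_deg_less n = {p. \<forall>i j. coeff (coeff p j) i \<noteq> 0 \<longrightarrow> i + j < n}"

text \<open>The affine polynomial \<open>X\<^sup>t D + E\<close>.\<close>

definition affine_poly :: "real vec \<Rightarrow> real \<Rightarrow> bipoly" where
  "affine_poly D E = const (vec_index D 0) * varx + const (vec_index D 1) * vary + const E"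


section \<open>Polynomial matrices\<close>

definition eval_mat :: "bipoly mat \<Rightarrow> real \<times> real \<Rightarrow> real mat" where
  "eval_mat A z = map_mat (\<lambda>p. eval p z) A"

definition row2 :: "'a \<Rightarrow> 'a \<Rightarrow> 'a mat" where
  "row2 a b = mat_of_rows_list 2 [[a, b]]"

definition grad :: "bipoly mat \<Rightarrow> bipoly mat" where
  "grad A = map_mat dx A @\<^sub>r map_mat dy A"

definition monomials :: "nat \<Rightarrow> bipoly mat" where
  "monomials n = mat (n + 1) 1 (\<lambda>(i, _). varx ^ (n - i) * vary ^ i)"

definition positive_definite :: "real mat \<Rightarrow> bool" where
  "positive_definite A \<longleftrightarrow> A \<in> carrier_mat (dim_row A) (dim_row A) \<and>
     (\<forall>\<xi> \<in> carrier_vec (dim_row A). \<xi> \<noteq> 0\<^sub>v (dim_row A) \<longrightarrow> scalar_prod \<xi> (A *\<^sub>v \<xi>) > 0)"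


section \<open>Families of polynomials and orthogonality with respect to a weight\<close>

text \<open>\<open>P n $$ (k, 0)\<close> is the polynomial \<open>P\<^bsub>n-k,k\<^esub>\<close>. Independence modulo lower degree
  forces every entry of \<open>P n\<close> to have degree exactly \<open>n\<close>.\<close>

definition polynomial_system :: "(nat \<Rightarrow> bipoly mat) \<Rightarrow> bool" where
  "polynomial_system P \<longleftrightarrow> (\<forall>n.
     P n \<in> carrier_mat (n + 1) 1 \<and>
     (\<forall>k\<le>n. P n $$ (k, 0) \<in> poly_deg_le n) \<and>
     (\<forall>c :: nat \<Rightarrow> real. (\<Sum>k\<le>n. const (c k) * P n $$ (k, 0)) \<in> poly_deg_less n
        \<longrightarrow> (\<forall>k\<le>n. c k = 0)))"

definition weight_function :: "(real \<times> real) set \<Rightarrow> (real \<times> real \<Rightarrow> real) \<Rightarrow> bool" where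
  "weight_function \<Omega> \<rho> \<longleftrightarrow> (\<forall>z\<in>\<Omega>. \<rho> z \<ge> 0) \<and> set_integrable lebesgue \<Omega> \<rho>"

definition weighted_integrable ::
    "(real \<times> real) set \<Rightarrow> (real \<times> real \<Rightarrow> real) \<Rightarrow> bipoly \<Rightarrow> bool" where
  "weighted_integrable \<Omega> \<rho> p \<longleftrightarrow> set_integrable lebesgue \<Omega> (\<lambda>z. eval p z * \<rho> z)"

definition weighted_integral ::
    "(real \<times> real) set \<Rightarrow> (real \<times> real \<Rightarrow> real) \<Rightarrow> bipoly \<Rightarrow> real" where
  "weighted_integral \<Omega> \<rho> p = (LINT z:\<Omega>|lebesgue. eval p z * \<rho> z)"

text \<open>The Bochner integral of a non-integrable function is \<open>0\<close>, so the existence of the integrals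
  that occur in the orthogonality relations has to be stated separately.\<close>

definition orthogonal_wrt_weight ::
    "(real \<times> real) set \<Rightarrow> (real \<times> real \<Rightarrow> real) \<Rightarrow> (nat \<Rightarrow> bipoly mat) \<Rightarrow> bool" where
  "orthogonal_wrt_weight \<Omega> \<rho> P \<longleftrightarrow>
     polynomial_system P \<and>
     (\<forall>n. \<forall>m\<le>n. \<forall>i\<le>m. \<forall>k\<le>n.
        weighted_integrable \<Omega> \<rho> ((monomials m * transpose_mat (P n)) $$ (i, k))) \<and>
     (\<forall>n. \<forall>m<n. map_mat (weighted_integral \<Omega> \<rho>) (monomials m * transpose_mat (P n))
        = 0\<^sub>m (m + 1) (n + 1)) \<and>
     (\<forall>n. invertible_mat (map_mat (weighted_integral \<Omega> \<rho>) (monomials n * transpose_mat (P n))))"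


section \<open>Outer normals and the boundary condition\<close>

text \<open>A unit vector \<open>\<nu>\<close> is the outer normal of \<open>\<partial>S\<close> at \<open>z\<close> if, to first order at \<open>z\<close>, the set \<open>S\<close> is
  the half-plane \<open>{w. (w - z) \<cdot> \<nu> < 0}\<close>. Such a \<open>\<nu>\<close> is unique, it is the usual outer normal wherever
  \<open>S\<close> lies on one side of a regular \<open>C\<^sup>1\<close> boundary arc, and there is none at a corner.\<close>

definition outer_normal :: "(real \<times> real) set \<Rightarrow> real \<times> real \<Rightarrow> real \<times> real \<Rightarrow> bool" where
  "outer_normal S z \<nu> \<longleftrightarrow> z \<in> frontier S \<and> norm \<nu> = 1 \<and>
     (\<forall>\<epsilon>>0. \<exists>\<delta>>0. \<forall>w. dist w z < \<delta> \<longrightarrow>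
        (inner (w - z) \<nu> < - \<epsilon> * norm (w - z) \<longrightarrow> w \<in> S) \<and>
        (inner (w - z) \<nu> > \<epsilon> * norm (w - z) \<longrightarrow> w \<notin> S))"

text \<open>The boundary condition below speaks about the outer normal of the boundary, hence makes sense
  only on sets whose boundary has one, up to exceptional points such as corners. We ask only that the
  exceptional points have empty relative interior in the boundary. On a domain with no boundary
  normals at all (such as a snowflake domain) the boundary condition would be void, and a
  Gaussian weight would be classical although its moment functional violates Pearson's equation.\<close>

definition has_outer_normals :: "(real \<times> real) set \<Rightarrow> bool" where
  "has_outer_normals S \<longleftrightarrow> frontier S \<subseteq> closure {z \<in> frontier S. \<exists>\<nu>. outer_normal S z \<nu>}"

text \<open>\<open>(\<rho> \<Phi> \<nabla>u)(w) \<cdot> \<nu>\<close>, where the dot product of the \<open>2 \<times> n\<close> matrix with rows \<open>A\<close>, \<open>B\<close> with \<open>\<nu>\<close> is the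
  row \<open>A \<nu>\<^sub>x + B \<nu>\<^sub>y\<close>.\<close>

definition flux :: "(real \<times> real \<Rightarrow> real) \<Rightarrow> bipoly mat \<Rightarrow> bipoly mat \<Rightarrow>
    real \<times> real \<Rightarrow> real \<times> real \<Rightarrow> real mat" where
  "flux \<rho> \<Phi> u w \<nu> = (let M = \<rho> w \<cdot>\<^sub>m eval_mat (\<Phi> * grad u) w in
     mat 1 (dim_col M) (\<lambda>(_, k). M $$ (0, k) * fst \<nu> + M $$ (1, k) * snd \<nu>))"

text \<open>\<open>l\<close> is the value at \<open>z\<close> of \<open>1\<^bsub>\<partial>S\<^esub> F(\<cdot>, \<nu>)\<close>, with \<open>\<nu>\<close> the outer normal of \<open>\<partial>S\<close> and the boundary
  value taken as the limit from inside \<open>S\<close>. Nothing is required at boundary points without normal.\<close>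

definition boundary_value :: "(real \<times> real) set \<Rightarrow> (real \<times> real \<Rightarrow> real \<times> real \<Rightarrow> real) \<Rightarrow>
    real \<times> real \<Rightarrow> real \<Rightarrow> bool" where
  "boundary_value S F z l \<longleftrightarrow>
     (if z \<in> frontier S
      then \<forall>\<nu>. outer_normal S z \<nu> \<longrightarrow> ((\<lambda>w. F w \<nu>) \<longlongrightarrow> l) (at z within S)
      else l = 0)"

text \<open>The limit of the sequence of functions is pointwise, and entrywise for rows. The boundary value
  at \<open>z\<close> need only exist for all large \<open>j\<close>.\<close>

definition boundary_condition ::
    "(real \<times> real) set \<Rightarrow> (real \<times> real \<Rightarrow> real) \<Rightarrow> bipoly mat \<Rightarrow> bool" where
  "boundary_condition \<Omega> \<rho> \<Phi> \<longleftrightarrow>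
     (\<forall>n\<ge>1. \<forall>u \<in> carrier_mat 1 n. \<forall>k<n. \<forall>z. \<exists>l :: nat \<Rightarrow> real.
        (\<forall>\<^sub>F j in sequentially.
           boundary_value (\<Omega> \<inter> ball 0 (real j)) (\<lambda>w \<nu>. flux \<rho> \<Phi> u w \<nu> $$ (0, k)) z (l j)) \<and>
        l \<longlonglongrightarrow> 0)"


section \<open>Classical weights\<close>

text \<open>\<open>div (\<rho> \<Phi>) = \<rho> (\<psi>\<^sub>1, \<psi>\<^sub>2)\<close> on \<open>\<Omega>\<close>; of \<open>\<rho>\<close> we ask no more than the existence of the partial
  derivatives that occur in the divergence.\<close>

definition weight_pearson :: "(real \<times> real) set \<Rightarrow> (real \<times> real \<Rightarrow> real) \<Rightarrow> bipoly mat \<Rightarrow>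
    bipoly \<Rightarrow> bipoly \<Rightarrow> bool" where
  "weight_pearson \<Omega> \<rho> \<Phi> \<psi>\<^sub>1 \<psi>\<^sub>2 \<longleftrightarrow>
     (\<forall>(x, y) \<in> \<Omega>. \<forall>j<2. \<exists>a b.
        ((\<lambda>t. \<rho> (t, y) * eval (\<Phi> $$ (0, j)) (t, y)) has_real_derivative a) (at x) \<and>
        ((\<lambda>t. \<rho> (x, t) * eval (\<Phi> $$ (1, j)) (x, t)) has_real_derivative b) (at y) \<and>
        a + b = \<rho> (x, y) * eval (row2 \<psi>\<^sub>1 \<psi>\<^sub>2 $$ (0, j)) (x, y))"

text \<open>\<open>\<rho>\<close> is a classical weight function on \<open>\<Omega>\<close>, with associated \<open>\<Phi>\<close>, \<open>\<psi>\<^sub>1\<close>, \<open>\<psi>\<^sub>2\<close>. Matrix indices start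
  at \<open>0\<close>, so \<open>\<Phi> $$ (i, j)\<close> is \<open>\<phi>\<^bsub>i+1,j+1\<^esub>\<close>. Positive definiteness of \<open>\<Phi>\<close> is meant pointwise on \<open>\<Omega>\<close>.\<close>

definition classical_weight :: "(real \<times> real) set \<Rightarrow> (real \<times> real \<Rightarrow> real) \<Rightarrow> bipoly mat \<Rightarrow>
    bipoly \<Rightarrow> bipoly \<Rightarrow> bool" where
  "classical_weight \<Omega> \<rho> \<Phi> \<psi>\<^sub>1 \<psi>\<^sub>2 \<longleftrightarrow>
     weight_function \<Omega> \<rho> \<and>
     \<Phi> \<in> carrier_mat 2 2 \<and>
     transpose_mat \<Phi> = \<Phi> \<and>
     (\<forall>z\<in>\<Omega>. positive_definite (eval_mat \<Phi> z)) \<and>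
     (\<forall>i<2. \<forall>j<2. \<Phi> $$ (i, j) \<in> poly_deg_le 2) \<and>
     boundary_condition \<Omega> \<rho> \<Phi> \<and>
     (\<forall>j<2. \<Phi> $$ (0, j) \<cdot>\<^sub>m map_mat dx \<Phi> + \<Phi> $$ (1, j) \<cdot>\<^sub>m map_mat dy \<Phi>
        = \<Phi> * grad (row2 (\<Phi> $$ (0, j)) (\<Phi> $$ (1, j)))) \<and>
     (\<exists>D\<^sub>1 \<in> carrier_vec 2. \<exists>D\<^sub>2 \<in> carrier_vec 2. \<exists>E\<^sub>1 E\<^sub>2.
        \<psi>\<^sub>1 = affine_poly D\<^sub>1 E\<^sub>1 \<and> \<psi>\<^sub>2 = affine_poly D\<^sub>2 E\<^sub>2 \<and>
        Determinant.det (mat_of_cols 2 [D\<^sub>1, D\<^sub>2]) \<noteq> 0) \<and>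
     weight_pearson \<Omega> \<rho> \<Phi> \<psi>\<^sub>1 \<psi>\<^sub>2"


section \<open>Moment functionals\<close>

type_synonym functional = "bipoly \<Rightarrow> real"

definition moment_functional :: "functional \<Rightarrow> bool" where
  "moment_functional w \<longleftrightarrow> Vector_Spaces.linear (\<lambda>c p. const c * p) (*\<^sub>R) w"

definition mult_functional :: "bipoly \<Rightarrow> functional \<Rightarrow> functional" where
  "mult_functional q w = (\<lambda>p. w (q * p))"

definition dx_functional :: "functional \<Rightarrow> functional" where
  "dx_functional w = (\<lambda>p. - w (dx p))"

definition dy_functional :: "functional \<Rightarrow> functional" where
  "dy_functional w = (\<lambda>p. - w (dy p))"

text \<open>The rows \<open>div (\<Phi> v)\<close> and \<open>(\<psi>\<^sub>1, \<psi>\<^sub>2) v\<close> of functionals.\<close>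

definition div_functional :: "bipoly mat \<Rightarrow> functional \<Rightarrow> functional mat" where
  "div_functional \<Phi> v = mat 1 2 (\<lambda>(_, j). \<lambda>p.
     dx_functional (mult_functional (\<Phi> $$ (0, j)) v) p +
     dy_functional (mult_functional (\<Phi> $$ (1, j)) v) p)"

definition mult_row_functional :: "bipoly mat \<Rightarrow> functional \<Rightarrow> functional mat" where
  "mult_row_functional A v = map_mat (\<lambda>q. mult_functional q v) A"

definition orthogonal_wrt_functional :: "functional \<Rightarrow> (nat \<Rightarrow> bipoly mat) \<Rightarrow> bool" where
  "orthogonal_wrt_functional v P \<longleftrightarrow>
     (\<forall>m n. m \<noteq> n \<longrightarrow> map_mat v (P m * transpose_mat (P n)) = 0\<^sub>m (m + 1) (n + 1)) \<and>
     (\<forall>n. invertible_mat (map_mat v (P n * transpose_mat (P n))))"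

end

theory Submission
  imports Defs
begin

text \<open>The hypothesis at the boundary is only qualitative: the flux tends to zero, pointwise, at the boundary
points that have a normal, and nothing at all is said at infinity. What makes Pearson's equation pass from
the weight to its moments is the rigidity that the compatibility condition on \<open>\<Phi>\<close> imposes.

Write \<open>\<Phi> = (a b; b c)\<close> and \<open>D = a c - b\<^sup>2\<close>, and let \<open>X\<^sub>1 = a \<partial>\<^sub>x + b \<partial>\<^sub>y\<close> and \<open>X\<^sub>2 = b \<partial>\<^sub>x + c \<partial>\<^sub>y\<close> be the
vector fields given by the columns of \<open>\<Phi>\<close>. Since \<open>D > 0\<close> on \<open>\<Omega>\<close>, Pearson's equation for \<open>\<rho>\<close> can be solved
for the logarithmic gradient of \<open>\<rho>\<close>, which is therefore a rational vector field with denominator \<open>D\<close>. Three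
consequences follow.

\<^item> The weight is continuous and, \<open>\<Omega>\<close> being connected, strictly positive unless it vanishes identically, which
the orthogonality excludes.

\<^item> At a boundary point with a normal, \<open>D\<close> vanishes: otherwise the logarithmic gradient would be bounded near
the point and \<open>\<rho>\<close> would stay away from zero along a segment ending there, while the boundary condition
and the invertibility of \<open>\<Phi>\<close> force \<open>\<rho>\<close> to tend to zero. By density and continuity, \<open>D = 0\<close> on the whole
boundary (\<open>D_eq_0_on_frontier\<close>).

\<^item> The compatibility condition says precisely that \<open>X\<^sub>1\<close> and \<open>X\<^sub>2\<close> commute, and commuting fields preserve
the bivector \<open>X\<^sub>1 \<and> X\<^sub>2\<close>, that is, \<open>X\<^sub>i D = D div X\<^sub>i\<close>. So both fields are tangent to the zero set of \<open>D\<close>,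
which contains the boundary, and no flux can cross it.

The last point is exploited without flows. The function \<open>q = 1/D + x\<^sup>2 + y\<^sup>2\<close> has compact sublevel sets in \<open>\<Omega>\<close>,
and \<open>X\<^sub>i q\<close> is at most \<open>q + 1\<close> times a function of polynomial growth. Multiplying the field \<open>p \<rho> X\<^sub>i\<close> by the cutoff
\<open>(max 0 (1 - \<epsilon> q))\<^sup>2\<close> makes it compactly supported in \<open>\<Omega>\<close>, so that its divergence has integral zero by
Fubini's theorem and the fundamental theorem of calculus; the term with the gradient of the cutoff is
dominated by an integrable function and disappears as \<open>\<epsilon> \<rightarrow> 0\<close>, by dominated convergence
(\<open>integral_divergence_eq_0\<close>). The only input at infinity is the existence of all moments, which
orthogonality provides. The resulting identity \<open>\<integral> (\<psi>\<^sub>i p + X\<^sub>i p) \<rho> = 0\<close> is the Pearson equation of the moment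
functional (\<open>weak_pearson\<close>).

The matrix \<open>\<langle>v, \<Phi>\<rangle>\<close> is nonsingular because it is an average of positive definite matrices with a positive weight.
Orthogonality with respect to the functional is linear algebra: the leading coefficients of the entries of \<open>P\<^sub>n\<close>
form an invertible matrix, so these entries, over all \<open>n\<close>, span the polynomials, and
\<open>\<langle>v, P\<^sub>n P\<^sub>n\<^sup>t\<rangle>\<close> is the product of that matrix and \<open>\<langle>v, X\<^sub>n P\<^sub>n\<^sup>t\<rangle>\<close>.\<close>

section \<open>Partial derivatives of polynomials\<close>

text \<open>Partial derivatives at a point are kept separate from total differentiability, because a weight is only
known to have partial derivatives.\<close>

definition has_dx :: "(real \<times> real \<Rightarrow> real) \<Rightarrow> real \<Rightarrow> real \<times> real \<Rightarrow> bool" where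
  "has_dx f d z \<longleftrightarrow> ((\<lambda>t. f (t, snd z)) has_real_derivative d) (at (fst z))"

definition has_dy :: "(real \<times> real \<Rightarrow> real) \<Rightarrow> real \<Rightarrow> real \<times> real \<Rightarrow> bool" where
  "has_dy f d z \<longleftrightarrow> ((\<lambda>t. f (fst z, t)) has_real_derivative d) (at (snd z))"

lemma eval_0 [simp]: "eval 0 z = 0" and eval_1 [simp]: "eval 1 z = 1"
  and eval_const [simp]: "eval (const c) z = c"
  and eval_varx [simp]: "eval varx z = fst z" and eval_vary [simp]: "eval vary z = snd z"
  and eval_add [simp]: "eval (p + q) z = eval p z + eval q z"
  and eval_mult [simp]: "eval (p * q) z = eval p z * eval q z"
  by (simp_all add: eval_def const_def varx_def vary_def)

lemma eval_pCons: "eval (pCons a p) z = poly a (fst z) + snd z * eval p z"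
  by (simp add: eval_def)

lemma continuous_on_eval [continuous_intros]: "continuous_on S (eval p)"
proof (induction p)
  case 0
  then show ?case by (simp add: eval_def)
next
  case (pCons a p)
  then show ?case
    unfolding eval_pCons by (intro continuous_intros)
qed

lemma has_dx_eval: "has_dx (eval p) (eval (dx p) z) z"
proof -
  have "pderiv (poly p [:y:]) = poly (dx p) [:y:]" for y
    by (induction p) (simp_all add: dx_def map_poly_pCons pderiv_add pderiv_mult pderiv_pCons pderiv_smult)
  then show ?thesis
    unfolding has_dx_def eval_def by (simp flip: \<open>\<And>y. pderiv (poly p [:y:]) = poly (dx p) [:y:]\<close>)
qed

lemma has_dy_eval: "has_dy (eval p) (eval (dy p) z) z"
proof -
  have "((\<lambda>t. eval p (x, t)) has_real_derivative eval (pderiv p) (x, y)) (at y)" for x y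
  proof (induction p)
    case (pCons a p)
    show ?case
      unfolding eval_pCons pderiv_pCons eval_add fst_conv snd_conv
      by (rule derivative_eq_intros pCons refl | simp)+
  qed simp
  from this[of "fst z" "snd z"] show ?thesis by (simp add: has_dy_def dy_def)
qed

lemma dx_varx [simp]: "dx varx = 1"
  by (simp add: dx_def varx_def map_poly_pCons pderiv_pCons flip: one_pCons)

lemma dy_varx [simp]: "dy varx = 0" and dx_vary [simp]: "dx vary = 0" and dy_vary [simp]: "dy vary = 1"
  by (simp_all add: dx_def dy_def varx_def vary_def map_poly_pCons pderiv_pCons)

lemma has_dx_unique: "has_dx f d z \<Longrightarrow> has_dx f d' z \<Longrightarrow> d = d'"
  unfolding has_dx_def by (rule DERIV_unique)

lemma has_dy_unique: "has_dy f d z \<Longrightarrow> has_dy f d' z \<Longrightarrow> d = d'"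
  unfolding has_dy_def by (rule DERIV_unique)

lemma has_dx_mult: "has_dx f d z \<Longrightarrow> has_dx g e z \<Longrightarrow> has_dx (\<lambda>w. f w * g w) (d * g z + e * f z) z"
  unfolding has_dx_def by (drule (1) DERIV_mult) simp

lemma has_dy_mult: "has_dy f d z \<Longrightarrow> has_dy g e z \<Longrightarrow> has_dy (\<lambda>w. f w * g w) (d * g z + e * f z) z"
  unfolding has_dy_def by (drule (1) DERIV_mult) simp

text \<open>Used to extract the partial derivatives of the weight from those of the products \<open>\<rho> \<phi>\<^sub>i\<^sub>j\<close> in Pearson's equation.\<close>

lemma has_dx_cancel:
  assumes S: "open S" "z \<in> S" and fg: "has_dx (\<lambda>w. f w * g w) d z" and g: "has_dx g e z"
    and nz: "\<And>w. w \<in> S \<Longrightarrow> g w \<noteq> 0"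
  shows "has_dx f ((d - f z * e) / g z) z"
proof -
  have gz: "g z \<noteq> 0" using nz S by blast
  have "((\<lambda>t. f (t, snd z) * g (t, snd z) / g (t, snd z)) has_real_derivative (d * g z - (f z * g z) * e) / (g z * g z)) (at (fst z))"
    using DERIV_divide[OF fg[unfolded has_dx_def] g[unfolded has_dx_def]] gz by simp
  moreover have "(d * g z - (f z * g z) * e) / (g z * g z) = (d - f z * e) / g z"
    using gz by (simp add: divide_simps) (simp add: algebra_simps)
  ultimately have "((\<lambda>t. f (t, snd z) * g (t, snd z) / g (t, snd z)) has_real_derivative (d - f z * e) / g z) (at (fst z))"
    by simp
  then show ?thesis unfolding has_dx_def
    by (rule has_field_derivative_transform_within_open[of _ _ _ "(\<lambda>t. (t, snd z)) -` S"])
      (use S nz in \<open>auto intro!: open_vimage continuous_intros\<close>)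
qed

lemma has_dy_cancel:
  assumes S: "open S" "z \<in> S" and fg: "has_dy (\<lambda>w. f w * g w) d z" and g: "has_dy g e z"
    and nz: "\<And>w. w \<in> S \<Longrightarrow> g w \<noteq> 0"
  shows "has_dy f ((d - f z * e) / g z) z"
proof -
  have gz: "g z \<noteq> 0" using nz S by blast
  have "((\<lambda>t. f (fst z, t) * g (fst z, t) / g (fst z, t)) has_real_derivative (d * g z - (f z * g z) * e) / (g z * g z)) (at (snd z))"
    using DERIV_divide[OF fg[unfolded has_dy_def] g[unfolded has_dy_def]] gz by simp
  moreover have "(d * g z - (f z * g z) * e) / (g z * g z) = (d - f z * e) / g z"
    using gz by (simp add: divide_simps) (simp add: algebra_simps)
  ultimately have "((\<lambda>t. f (fst z, t) * g (fst z, t) / g (fst z, t)) has_real_derivative (d - f z * e) / g z) (at (snd z))"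
    by simp
  then show ?thesis unfolding has_dy_def
    by (rule has_field_derivative_transform_within_open[of _ _ _ "(\<lambda>t. (fst z, t)) -` S"])
      (use S nz in \<open>auto intro!: open_vimage continuous_intros\<close>)
qed

section \<open>Functions with bounded logarithmic derivatives\<close>

text \<open>A one-sided Gronwall inequality that runs along the segment in either direction: \<open>f\<close> times a suitable
exponential is monotone. It bounds the oscillation of \<open>f\<close> from both sides, since \<open>s\<close> and \<open>t\<close> may be exchanged.\<close>

lemma growth_le_exp:
  fixes f a :: "real \<Rightarrow> real"
  assumes der: "\<And>r. r \<in> closed_segment s t \<Longrightarrow> (f has_real_derivative a r * f r) (at r)"
    and bnd: "\<And>r. r \<in> closed_segment s t \<Longrightarrow> \<bar>a r\<bar> \<le> C"
    and nonneg: "\<And>r. r \<in> closed_segment s t \<Longrightarrow> f r \<ge> 0"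
  shows "f t \<le> f s * exp (C * \<bar>t - s\<bar>)"
proof (cases "s \<le> t")
  case True
  have "f t * exp (- C * t) \<le> f s * exp (- C * s)"
  proof (rule DERIV_nonpos_imp_nonincreasing[OF True])
    fix r assume "s \<le> r" "r \<le> t"
    then have r: "r \<in> closed_segment s t" by (simp add: closed_segment_eq_real_ivl)
    have "((\<lambda>r. f r * exp (- C * r)) has_real_derivative (a r - C) * (f r * exp (- C * r))) (at r)"
      by (rule derivative_eq_intros der r refl | simp add: algebra_simps)+
    moreover have "(a r - C) * (f r * exp (- C * r)) \<le> 0"
      using bnd[OF r] nonneg[OF r] by (intro mult_nonpos_nonneg) auto
    ultimately show "\<exists>y. ((\<lambda>r. f r * exp (- C * r)) has_real_derivative y) (at r) \<and> y \<le> 0" by blast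
  qed
  then have "(f t * exp (- C * t)) * exp (C * t) \<le> (f s * exp (- C * s)) * exp (C * t)"
    by (rule mult_right_mono) simp
  moreover have "(f t * exp (- C * t)) * exp (C * t) = f t"
    "(f s * exp (- C * s)) * exp (C * t) = f s * exp (C * (t - s))"
    by (simp_all add: algebra_simps exp_diff exp_minus divide_inverse)
  ultimately have "f t \<le> f s * exp (C * (t - s))" by metis
  then show ?thesis using True by simp
next
  case False
  then have le: "t \<le> s" by simp
  have "f t * exp (C * t) \<le> f s * exp (C * s)"
  proof (rule DERIV_nonneg_imp_nondecreasing[OF le])
    fix r assume "t \<le> r" "r \<le> s"
    then have r: "r \<in> closed_segment s t" by (simp add: closed_segment_eq_real_ivl)
    have "((\<lambda>r. f r * exp (C * r)) has_real_derivative (a r + C) * (f r * exp (C * r))) (at r)"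
      by (rule derivative_eq_intros der r refl | simp add: algebra_simps)+
    moreover have "0 \<le> (a r + C) * (f r * exp (C * r))"
      using bnd[OF r] nonneg[OF r] by (intro mult_nonneg_nonneg) auto
    ultimately show "\<exists>y. ((\<lambda>r. f r * exp (C * r)) has_real_derivative y) (at r) \<and> 0 \<le> y" by blast
  qed
  then have "(f t * exp (C * t)) * exp (- C * t) \<le> (f s * exp (C * s)) * exp (- C * t)"
    by (rule mult_right_mono) simp
  moreover have "(f t * exp (C * t)) * exp (- C * t) = f t"
    "(f s * exp (C * s)) * exp (- C * t) = f s * exp (C * (s - t))"
    by (simp_all add: algebra_simps exp_diff exp_minus divide_inverse)
  ultimately have "f t \<le> f s * exp (C * (s - t))" by metis
  then show ?thesis using False by simp
qed

text \<open>The two points are joined by a horizontal and then a vertical segment; along each of these only one partial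
derivative matters.\<close>

lemma growth_le_exp_ball:
  fixes \<rho> \<alpha> \<beta> :: "real \<times> real \<Rightarrow> real"
  assumes dx: "\<And>w. w \<in> ball z r \<Longrightarrow> has_dx \<rho> (\<alpha> w * \<rho> w) w"
    and dy: "\<And>w. w \<in> ball z r \<Longrightarrow> has_dy \<rho> (\<beta> w * \<rho> w) w"
    and \<alpha>: "\<And>w. w \<in> ball z r \<Longrightarrow> \<bar>\<alpha> w\<bar> \<le> C" and \<beta>: "\<And>w. w \<in> ball z r \<Longrightarrow> \<bar>\<beta> w\<bar> \<le> C"
    and nonneg: "\<And>w. w \<in> ball z r \<Longrightarrow> \<rho> w \<ge> 0" and w: "w \<in> ball z r"
  shows "\<rho> w \<le> \<rho> z * exp (2 * C * dist z w)" "\<rho> z \<le> \<rho> w * exp (2 * C * dist z w)"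
proof -
  \<comment> \<open>The corner of the path from \<open>z\<close> to \<open>w\<close>.\<close>
  define m where "m = (fst w, snd z)"
  have le: "\<bar>fst w - fst z\<bar> \<le> dist z w" "\<bar>snd w - snd z\<bar> \<le> dist z w"
    using dist_fst_le[of w z] dist_snd_le[of w z] by (auto simp: dist_real_def dist_commute)
  have r: "0 < r" using w by (auto intro: le_less_trans[OF zero_le_dist])
  have C: "C \<ge> 0" using \<alpha>[of z] r by force
  have H: "(t, snd z) \<in> ball z r" if "t \<in> closed_segment (fst z) (fst w)" for t
  proof -
    have "dist z (t, snd z) = \<bar>fst z - t\<bar>" by (simp add: dist_prod_def dist_real_def)
    also have "\<dots> \<le> \<bar>fst w - fst z\<bar>" using that by (auto simp: closed_segment_eq_real_ivl split: if_splits)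
    finally show ?thesis using le w by auto
  qed
  have V: "(fst w, t) \<in> ball z r" if "t \<in> closed_segment (snd z) (snd w)" for t
  proof -
    have "\<bar>snd z - t\<bar> \<le> \<bar>snd z - snd w\<bar>" using that by (auto simp: closed_segment_eq_real_ivl split: if_splits)
    then have "dist z (fst w, t) \<le> dist z w"
      by (auto simp: dist_prod_def dist_real_def intro!: real_sqrt_le_mono simp flip: abs_le_square_iff)
    then show ?thesis using w by auto
  qed
  note V' = V[unfolded closed_segment_commute[of "snd z"]] and H' = H[unfolded closed_segment_commute[of "fst z"]]
  have L1: "\<rho> m \<le> \<rho> z * exp (C * \<bar>fst w - fst z\<bar>)"
    using growth_le_exp[of "fst z" "fst w" "\<lambda>t. \<rho> (t, snd z)" "\<lambda>t. \<alpha> (t, snd z)" C]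
      dx[OF H] \<alpha>[OF H] nonneg[OF H] by (simp add: m_def has_dx_def)
  have L2: "\<rho> w \<le> \<rho> m * exp (C * \<bar>snd w - snd z\<bar>)"
    using growth_le_exp[of "snd z" "snd w" "\<lambda>t. \<rho> (fst w, t)" "\<lambda>t. \<beta> (fst w, t)" C]
      dy[OF V] \<beta>[OF V] nonneg[OF V] by (simp add: m_def has_dy_def)
  have L3: "\<rho> z \<le> \<rho> m * exp (C * \<bar>fst z - fst w\<bar>)"
    using growth_le_exp[of "fst w" "fst z" "\<lambda>t. \<rho> (t, snd z)" "\<lambda>t. \<alpha> (t, snd z)" C]
      dx[OF H'] \<alpha>[OF H'] nonneg[OF H'] by (simp add: m_def has_dx_def)
  have L4: "\<rho> m \<le> \<rho> w * exp (C * \<bar>snd z - snd w\<bar>)"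
    using growth_le_exp[of "snd w" "snd z" "\<lambda>t. \<rho> (fst w, t)" "\<lambda>t. \<beta> (fst w, t)" C]
      dy[OF V'] \<beta>[OF V'] nonneg[OF V'] by (simp add: m_def has_dy_def)
  have mono: "b * exp (C * s) \<le> b * exp (C * dist z w)" if "s \<le> dist z w" "b \<ge> 0" for s b
    using that C by (intro mult_left_mono) (auto intro: mult_left_mono)
  have pos: "\<rho> z \<ge> 0" "\<rho> w \<ge> 0" "\<rho> m \<ge> 0"
    using nonneg[of z] nonneg[OF w] r nonneg[OF H[of "fst w"]] by (auto simp: m_def)
  have le: "\<rho> m \<le> \<rho> z * exp (C * dist z w)" "\<rho> w \<le> \<rho> m * exp (C * dist z w)"
      "\<rho> z \<le> \<rho> m * exp (C * dist z w)" "\<rho> m \<le> \<rho> w * exp (C * dist z w)"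
    using order_trans[OF L1 mono[OF le(1) pos(1)]] order_trans[OF L2 mono[OF le(2) pos(3)]]
      order_trans[OF L3 mono[OF _ pos(3)]] order_trans[OF L4 mono[OF _ pos(2)]] le
    by (simp_all add: abs_minus_commute)
  have E: "exp (2 * C * dist z w) = exp (C * dist z w) * exp (C * dist z w)"
    by (simp flip: exp_add)
  show "\<rho> w \<le> \<rho> z * exp (2 * C * dist z w)" "\<rho> z \<le> \<rho> w * exp (2 * C * dist z w)"
    unfolding E mult.assoc[symmetric]
    using order_trans[OF le(2) mult_right_mono[OF le(1)]] order_trans[OF le(3) mult_right_mono[OF le(4)]]
    by simp_all
qed

lemma locally_bounded_ball:
  fixes \<alpha> :: "real \<times> real \<Rightarrow> real"
  assumes "open S" "continuous_on S \<alpha>" "z \<in> S"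
  obtains r where "r > 0" "ball z r \<subseteq> S" "\<And>w. w \<in> ball z r \<Longrightarrow> \<bar>\<alpha> w\<bar> \<le> \<bar>\<alpha> z\<bar> + 1"
proof -
  have "isCont \<alpha> z" using assms continuous_on_eq_continuous_at by blast
  then obtain d where d: "d > 0" "\<And>w. dist w z < d \<Longrightarrow> dist (\<alpha> w) (\<alpha> z) < 1"
    unfolding continuous_at_eps_delta by (elim allE[of _ 1]) auto
  obtain e where e: "e > 0" "ball z e \<subseteq> S" using assms openE by blast
  show thesis
  proof (rule that[of "min d e"])
    show "\<bar>\<alpha> w\<bar> \<le> \<bar>\<alpha> z\<bar> + 1" if "w \<in> ball z (min d e)" for w
      using d(2)[of w] that by (auto simp: dist_real_def dist_commute)
  qed (use d e in auto)
qed

text \<open>Locally the values of \<open>\<rho>\<close> are comparable with each other up to factors near 1. This gives continuity, and it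
makes both \<open>{\<rho> > 0}\<close> and \<open>{\<rho> = 0}\<close> open, so that connectedness leaves only one of them.\<close>

lemma
  fixes \<rho> \<alpha> \<beta> :: "real \<times> real \<Rightarrow> real"
  assumes "open S" "continuous_on S \<alpha>" "continuous_on S \<beta>"
    and dx: "\<And>w. w \<in> S \<Longrightarrow> has_dx \<rho> (\<alpha> w * \<rho> w) w"
    and dy: "\<And>w. w \<in> S \<Longrightarrow> has_dy \<rho> (\<beta> w * \<rho> w) w"
    and nonneg: "\<And>w. w \<in> S \<Longrightarrow> \<rho> w \<ge> 0"
  shows log_differentiable_continuous_on: "continuous_on S \<rho>"
    and log_differentiable_pos: "connected S \<Longrightarrow> z\<^sub>0 \<in> S \<Longrightarrow> \<rho> z\<^sub>0 > 0 \<Longrightarrow> z \<in> S \<Longrightarrow> \<rho> z > 0"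
proof -
  have *: "\<exists>r>0. \<exists>C. ball z r \<subseteq> S \<and> (\<forall>w\<in>ball z r. \<rho> w \<le> \<rho> z * exp (2 * C * dist z w) \<and>
      \<rho> z \<le> \<rho> w * exp (2 * C * dist z w))" if z: "z \<in> S" for z
  proof -
    obtain r where r: "r > 0" "ball z r \<subseteq> S" "\<And>w. w \<in> ball z r \<Longrightarrow> \<bar>\<alpha> w\<bar> \<le> \<bar>\<alpha> z\<bar> + 1"
      using locally_bounded_ball assms(1,2) z by blast
    obtain s where s: "s > 0" "ball z s \<subseteq> S" "\<And>w. w \<in> ball z s \<Longrightarrow> \<bar>\<beta> w\<bar> \<le> \<bar>\<beta> z\<bar> + 1"
      using locally_bounded_ball assms(1,3) z by blast
    define C where "C = max (\<bar>\<alpha> z\<bar> + 1) (\<bar>\<beta> z\<bar> + 1)"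
    have S: "w \<in> S" and \<alpha>: "\<bar>\<alpha> w\<bar> \<le> C" and \<beta>: "\<bar>\<beta> w\<bar> \<le> C" if "w \<in> ball z (min r s)" for w
      using that r(2) r(3)[of w] s(3)[of w] by (auto simp: C_def)
    note est = growth_le_exp_ball[of z "min r s" \<rho> \<alpha> \<beta> C, OF dx[OF S] dy[OF S] \<alpha> \<beta> nonneg[OF S]]
    have "ball z (min r s) \<subseteq> S" using r by auto
    then show ?thesis
      using r(1) s(1) est by (intro exI[of _ "min r s"] conjI exI[of _ C] ballI) auto
  qed
  show "continuous_on S \<rho>"
    unfolding continuous_on_eq_continuous_at[OF \<open>open S\<close>]
  proof
    fix z assume "z \<in> S"
    then obtain r C where r: "r > 0" "\<And>w. w \<in> ball z r \<Longrightarrow> \<rho> w \<le> \<rho> z * exp (2 * C * dist z w) \<and>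
        \<rho> z \<le> \<rho> w * exp (2 * C * dist z w)" using * by blast
    have ev: "\<forall>\<^sub>F w in at z. w \<in> ball z r" by (rule eventually_at_in_open') (use r in auto)
    show "isCont \<rho> z" unfolding isCont_def
    proof (rule tendsto_sandwich)
      show "\<forall>\<^sub>F w in at z. \<rho> z * exp (- (2 * C * dist z w)) \<le> \<rho> w"
        using ev
      proof eventually_elim
        case (elim w)
        have "\<rho> z * exp (- (2 * C * dist z w)) \<le> \<rho> w * exp (2 * C * dist z w) * exp (- (2 * C * dist z w))"
          by (rule mult_right_mono) (use r(2)[OF elim] in auto)
        then show ?case by (simp add: mult.assoc flip: exp_add)
      qed
      show "\<forall>\<^sub>F w in at z. \<rho> w \<le> \<rho> z * exp (2 * C * dist z w)"
        using ev by eventually_elim (use r in auto)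
      have d: "((\<lambda>w. dist z w) \<longlongrightarrow> 0) (at z)"
        using tendsto_dist[OF tendsto_const[of z] tendsto_ident_at[of z UNIV]] by simp
      show "((\<lambda>w. \<rho> z * exp (- (2 * C * dist z w))) \<longlongrightarrow> \<rho> z) (at z)"
        by (rule tendsto_eq_intros d refl | simp)+
      show "((\<lambda>w. \<rho> z * exp (2 * C * dist z w)) \<longlongrightarrow> \<rho> z) (at z)"
        by (rule tendsto_eq_intros d refl | simp)+
    qed
  qed
  assume "connected S" "z\<^sub>0 \<in> S" "\<rho> z\<^sub>0 > 0" "z \<in> S"
  let ?A = "{z \<in> S. \<rho> z > 0}" and ?B = "{z \<in> S. \<rho> z = 0}"
  have "open ?A" "open ?B"
    unfolding open_contains_ball
  proof safe
    fix z assume z: "z \<in> S"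
    then obtain r C where r: "r > 0" "ball z r \<subseteq> S" "\<And>w. w \<in> ball z r \<Longrightarrow> \<rho> w \<le> \<rho> z * exp (2 * C * dist z w)"
        "\<And>w. w \<in> ball z r \<Longrightarrow> \<rho> z \<le> \<rho> w * exp (2 * C * dist z w)" using * by blast
    show "\<exists>e>0. ball z e \<subseteq> ?A" if "\<rho> z > 0"
    proof (intro exI conjI subsetI)
      fix w assume w: "w \<in> ball z r"
      have "0 < \<rho> w * exp (2 * C * dist z w)" using r(4)[OF w] that by linarith
      then show "w \<in> ?A" using w r(2) by (auto simp: zero_less_mult_iff)
    qed fact
    show "\<exists>e>0. ball z e \<subseteq> ?B" if "\<rho> z = 0"
    proof (intro exI conjI subsetI)
      fix w assume w: "w \<in> ball z r"
      then show "w \<in> ?B" using r(2) r(3)[OF w] that nonneg[of w] by force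
    qed fact
  qed
  moreover have "S \<subseteq> ?A \<union> ?B" using nonneg by force
  moreover have "?A \<inter> ?B \<inter> S = {}" by auto
  ultimately have "?A \<inter> S = {} \<or> ?B \<inter> S = {}" using \<open>connected S\<close> connectedD by blast
  then show "\<rho> z > 0" using \<open>z\<^sub>0 \<in> S\<close> \<open>\<rho> z\<^sub>0 > 0\<close> \<open>z \<in> S\<close> nonneg[of z] by force
qed

text \<open>The sign \<open>s\<close> lets the point \<open>x\<close> be approached from the right or from the left.\<close>

lemma not_tendsto_0_of_bounded_growth:
  fixes f a :: "real \<Rightarrow> real"
  assumes t1: "t\<^sub>1 > 0" and s: "\<bar>s\<bar> = 1"
    and der: "\<And>t. 0 < t \<Longrightarrow> t \<le> t\<^sub>1 \<Longrightarrow> (f has_real_derivative a (x + s * t) * f (x + s * t)) (at (x + s * t))"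
    and bnd: "\<And>t. 0 < t \<Longrightarrow> t \<le> t\<^sub>1 \<Longrightarrow> \<bar>a (x + s * t)\<bar> \<le> C"
    and pos: "\<And>t. 0 < t \<Longrightarrow> t \<le> t\<^sub>1 \<Longrightarrow> f (x + s * t) > 0"
  shows "\<not> ((\<lambda>t. f (x + s * t)) \<longlongrightarrow> 0) (at_right 0)"
proof
  assume lim: "((\<lambda>t. f (x + s * t)) \<longlongrightarrow> 0) (at_right 0)"
  have C: "C \<ge> 0" using bnd[of t\<^sub>1] t1 by linarith
  have s': "s = 1 \<or> s = -1" using s by linarith
  have seg: "\<exists>t'. 0 < t' \<and> t' \<le> t\<^sub>1 \<and> r = x + s * t'"
    if "0 < t" "t \<le> t\<^sub>1" "r \<in> closed_segment (x + s * t) (x + s * t\<^sub>1)" for t r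
    by (rule exI[of _ "s * (r - x)"]) (use that s' in \<open>auto simp: closed_segment_eq_real_ivl split: if_splits\<close>)
  have le: "f (x + s * t\<^sub>1) \<le> f (x + s * t) * exp (C * t\<^sub>1)" if t: "0 < t" "t \<le> t\<^sub>1" for t
  proof -
    have "f (x + s * t\<^sub>1) \<le> f (x + s * t) * exp (C * \<bar>x + s * t\<^sub>1 - (x + s * t)\<bar>)"
    proof (rule growth_le_exp[of _ _ _ a])
      fix r assume "r \<in> closed_segment (x + s * t) (x + s * t\<^sub>1)"
      then obtain t' where t': "0 < t'" "t' \<le> t\<^sub>1" "r = x + s * t'" using seg t by blast
      show "(f has_real_derivative a r * f r) (at r)" "\<bar>a r\<bar> \<le> C" "f r \<ge> 0"
        using der[OF t'(1,2)] bnd[OF t'(1,2)] pos[OF t'(1,2)] by (simp_all add: t'(3))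
    qed
    also have "\<dots> \<le> f (x + s * t) * exp (C * t\<^sub>1)"
      using C t s' pos[OF t] by (intro mult_left_mono) (auto intro!: mult_left_mono)
    finally show ?thesis .
  qed
  have "((\<lambda>t. f (x + s * t) * exp (C * t\<^sub>1)) \<longlongrightarrow> 0 * exp (C * t\<^sub>1)) (at_right 0)"
    by (intro tendsto_intros lim)
  moreover have "\<forall>\<^sub>F t in at_right 0. f (x + s * t\<^sub>1) \<le> f (x + s * t) * exp (C * t\<^sub>1)"
    by (rule eventually_at_rightI[of 0 t\<^sub>1]) (use t1 in \<open>auto intro: le\<close>)
  ultimately have "f (x + s * t\<^sub>1) \<le> 0 * exp (C * t\<^sub>1)"
    by (intro tendsto_lowerbound[of _ _ "at_right 0"]) auto
  then show False using pos[of t\<^sub>1] t1 by simp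
qed

lemma outer_normal_cone:
  assumes "outer_normal S z \<nu>"
  obtains d where "d > 0" "\<And>w. dist w z < d \<Longrightarrow> inner (w - z) \<nu> < - norm (w - z) / 2 \<Longrightarrow> w \<in> S"
proof -
  have "\<forall>\<epsilon>>0. \<exists>\<delta>>0. \<forall>w. dist w z < \<delta> \<longrightarrow>
        (inner (w - z) \<nu> < - \<epsilon> * norm (w - z) \<longrightarrow> w \<in> S)"
    using assms unfolding outer_normal_def by meson
  from this[rule_format, of "1/2"] show thesis using that by auto
qed

text \<open>The region contains a cone around the inner normal that is wide enough, with opening constant 1/2, to contain
a segment parallel to one of the axes: a unit vector has a coordinate of modulus greater than 1/2. Along such a
segment a single partial derivative of \<open>\<rho>\<close> controls the growth.\<close>

lemma not_tendsto_0_at_outer_normal: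
  fixes \<rho> \<alpha> \<beta> :: "real \<times> real \<Rightarrow> real"
  assumes normal: "outer_normal S z \<nu>" and r: "r > 0"
    and dx: "\<And>w. w \<in> S \<Longrightarrow> has_dx \<rho> (\<alpha> w * \<rho> w) w"
    and dy: "\<And>w. w \<in> S \<Longrightarrow> has_dy \<rho> (\<beta> w * \<rho> w) w"
    and \<alpha>: "\<And>w. w \<in> ball z r \<Longrightarrow> \<bar>\<alpha> w\<bar> \<le> C" and \<beta>: "\<And>w. w \<in> ball z r \<Longrightarrow> \<bar>\<beta> w\<bar> \<le> C"
    and pos: "\<And>w. w \<in> S \<Longrightarrow> \<rho> w > 0"
  shows "\<not> (\<rho> \<longlongrightarrow> 0) (at z within S)"
proof
  assume lim: "(\<rho> \<longlongrightarrow> 0) (at z within S)"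
  obtain d where d: "d > 0" "\<And>w. dist w z < d \<Longrightarrow> inner (w - z) \<nu> < - norm (w - z) / 2 \<Longrightarrow> w \<in> S"
    using outer_normal_cone[OF normal] by blast
  obtain x y where z: "z = (x, y)" by fastforce
  obtain n m where \<nu>: "\<nu> = (n, m)" by fastforce
  define t\<^sub>1 where "t\<^sub>1 = min d r / 2"
  have t1: "0 < t\<^sub>1" "t\<^sub>1 < d" "t\<^sub>1 < r" using d(1) r by (auto simp: t\<^sub>1_def min_def)
  have nm: "n\<^sup>2 + m\<^sup>2 = 1"
    using normal by (simp add: outer_normal_def \<nu> norm_prod_def)
  have "\<bar>n\<bar> > 1/2 \<or> \<bar>m\<bar> > 1/2"
  proof (rule ccontr)
    assume "\<not> ?thesis"
    then have "n\<^sup>2 \<le> (1/2)\<^sup>2" "m\<^sup>2 \<le> (1/2)\<^sup>2" by (auto simp flip: abs_le_square_iff)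
    then show False using nm by (simp add: power2_eq_square)
  qed
  then show False
  proof
    assume n: "\<bar>n\<bar> > 1/2"
    define s where "s = - sgn n"
    have s: "\<bar>s\<bar> = 1" "s * n < - 1/2" using n by (auto simp: s_def sgn_if)
    have S: "(x + s * t, y) \<in> S" if t: "0 < t" "t \<le> t\<^sub>1" for t
    proof (rule d(2))
      show "dist (x + s * t, y) z < d"
        using t t1 s by (simp add: z dist_prod_def dist_real_def abs_mult)
      have "inner ((x + s * t, y) - z) \<nu> = t * (s * n)" "norm ((x + s * t, y) - z) = t"
        using t s by (simp_all add: z \<nu> inner_prod_def norm_prod_def abs_mult)
      moreover have "t * (s * n) < t * (- 1/2)" using t s by (intro mult_strict_left_mono) auto
      ultimately show "inner ((x + s * t, y) - z) \<nu> < - norm ((x + s * t, y) - z) / 2" by simp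
    qed
    have B: "(x + s * t, y) \<in> ball z r" if t: "0 < t" "t \<le> t\<^sub>1" for t
      using t t1 s by (simp add: z dist_prod_def dist_real_def abs_mult)
    have "filterlim (\<lambda>t. (x + s * t, y)) (at z within S) (at_right 0)"
      unfolding filterlim_at
    proof
      show "((\<lambda>t. (x + s * t, y)) \<longlongrightarrow> z) (at_right 0)"
        unfolding z by (rule tendsto_eq_intros refl | simp)+
      show "\<forall>\<^sub>F t in at_right 0. (x + s * t, y) \<in> S \<and> (x + s * t, y) \<noteq> z"
        using t1 s by (intro eventually_at_rightI[of 0 t\<^sub>1]) (auto simp: z intro: S)
    qed
    from filterlim_compose[OF lim this]
    show False
      using not_tendsto_0_of_bounded_growth[of t\<^sub>1 s "\<lambda>t. \<rho> (t, y)" "\<lambda>t. \<alpha> (t, y)" x C]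
        t1 s(1) dx[OF S] \<alpha>[OF B] pos[OF S] by (simp add: has_dx_def)
  next
    assume m: "\<bar>m\<bar> > 1/2"
    define s where "s = - sgn m"
    have s: "\<bar>s\<bar> = 1" "s * m < - 1/2" using m by (auto simp: s_def sgn_if)
    have S: "(x, y + s * t) \<in> S" if t: "0 < t" "t \<le> t\<^sub>1" for t
    proof (rule d(2))
      show "dist (x, y + s * t) z < d"
        using t t1 s by (simp add: z dist_prod_def dist_real_def abs_mult)
      have "inner ((x, y + s * t) - z) \<nu> = t * (s * m)" "norm ((x, y + s * t) - z) = t"
        using t s by (simp_all add: z \<nu> inner_prod_def norm_prod_def abs_mult)
      moreover have "t * (s * m) < t * (- 1/2)" using t s by (intro mult_strict_left_mono) auto
      ultimately show "inner ((x, y + s * t) - z) \<nu> < - norm ((x, y + s * t) - z) / 2" by simp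
    qed
    have B: "(x, y + s * t) \<in> ball z r" if t: "0 < t" "t \<le> t\<^sub>1" for t
      using t t1 s by (simp add: z dist_prod_def dist_real_def abs_mult)
    have "filterlim (\<lambda>t. (x, y + s * t)) (at z within S) (at_right 0)"
      unfolding filterlim_at
    proof
      show "((\<lambda>t. (x, y + s * t)) \<longlongrightarrow> z) (at_right 0)"
        unfolding z by (rule tendsto_eq_intros refl | simp)+
      show "\<forall>\<^sub>F t in at_right 0. (x, y + s * t) \<in> S \<and> (x, y + s * t) \<noteq> z"
        using t1 s by (intro eventually_at_rightI[of 0 t\<^sub>1]) (auto simp: z intro: S)
    qed
    from filterlim_compose[OF lim this]
    show False
      using not_tendsto_0_of_bounded_growth[of t\<^sub>1 s "\<lambda>t. \<rho> (x, t)" "\<lambda>t. \<beta> (x, t)" y C]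
        t1 s(1) dy[OF S] \<beta>[OF B] pos[OF S] by (simp add: has_dy_def)
  qed
qed

section \<open>Outer normals and boundary values\<close>

lemma outer_normal_Int_open:
  assumes S: "open S" and T: "open T" "z \<in> T" and normal: "outer_normal S z \<nu>"
  shows "outer_normal (S \<inter> T) z \<nu>"
  unfolding outer_normal_def
proof (intro conjI allI impI)
  have z: "z \<in> closure S" "z \<notin> S"
    using normal S by (auto simp: outer_normal_def frontier_def interior_open)
  have "z \<in> closure (S \<inter> T)"
    using open_Int_closure_subset[OF T(1), of S] T(2) z(1) by (auto simp: Int_commute)
  then show "z \<in> frontier (S \<inter> T)"
    using z(2) S T by (auto simp: frontier_def interior_open)
  show "norm \<nu> = 1" using normal by (simp add: outer_normal_def)
  fix \<epsilon> :: real assume "\<epsilon> > 0"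
  then obtain \<delta> where \<delta>: "\<delta> > 0" "\<And>w. dist w z < \<delta> \<Longrightarrow>
        (inner (w - z) \<nu> < - \<epsilon> * norm (w - z) \<longrightarrow> w \<in> S) \<and>
        (inner (w - z) \<nu> > \<epsilon> * norm (w - z) \<longrightarrow> w \<notin> S)"
    using normal unfolding outer_normal_def by blast
  obtain \<gamma> where \<gamma>: "\<gamma> > 0" "ball z \<gamma> \<subseteq> T" using T openE by blast
  show "\<exists>\<delta>>0. \<forall>w. dist w z < \<delta> \<longrightarrow>
      (inner (w - z) \<nu> < - \<epsilon> * norm (w - z) \<longrightarrow> w \<in> S \<inter> T) \<and>
      (\<epsilon> * norm (w - z) < inner (w - z) \<nu> \<longrightarrow> w \<notin> S \<inter> T)"
  proof (intro exI[of _ "min \<delta> \<gamma>"] conjI allI impI)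
    show "0 < min \<delta> \<gamma>" using \<delta>(1) \<gamma>(1) by simp
    fix w assume w: "dist w z < min \<delta> \<gamma>"
    then have "dist w z < \<delta>" "w \<in> T" using \<gamma>(2) by (auto simp: dist_commute simp del: split_paired_All)
    then show "w \<in> S \<inter> T" if "inner (w - z) \<nu> < - \<epsilon> * norm (w - z)"
      using \<delta>(2) that by blast
    show "w \<notin> S \<inter> T" if "\<epsilon> * norm (w - z) < inner (w - z) \<nu>"
      using \<delta>(2) \<open>dist w z < \<delta>\<close> that by blast
  qed
qed

text \<open>Truncation by a ball does not change the region near \<open>z\<close>, so for large \<open>j\<close> all the boundary values \<open>l j\<close> are
the same limit, and a constant sequence with limit zero is zero.\<close>

lemma boundary_limit_eq_0:
  assumes S: "open S" and normal: "outer_normal S z \<nu>"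
    and bv: "\<forall>\<^sub>F j in sequentially. boundary_value (S \<inter> ball 0 (real j)) F z (l j)" and l: "l \<longlonglongrightarrow> 0"
  shows "((\<lambda>w. F w \<nu>) \<longlongrightarrow> 0) (at z within S)"
proof -
  have "\<forall>\<^sub>F j in sequentially. norm z < real j"
    using filterlim_real_sequentially by (auto simp: filterlim_at_top_dense)
  with bv have ev: "\<forall>\<^sub>F j in sequentially. ((\<lambda>w. F w \<nu>) \<longlongrightarrow> l j) (at z within S)"
  proof eventually_elim
    case (elim j)
    have normal': "outer_normal (S \<inter> ball 0 (real j)) z \<nu>"
      by (rule outer_normal_Int_open[OF S _ _ normal]) (use elim in auto)
    then have "z \<in> frontier (S \<inter> ball 0 (real j))" by (simp only: outer_normal_def)
    then have "\<forall>\<nu>. outer_normal (S \<inter> ball 0 (real j)) z \<nu> \<longrightarrow>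
        ((\<lambda>w. F w \<nu>) \<longlongrightarrow> l j) (at z within S \<inter> ball 0 (real j))"
      using elim(1) unfolding boundary_value_def by argo
    from this[rule_format, OF normal']
    have "((\<lambda>w. F w \<nu>) \<longlongrightarrow> l j) (at z within S \<inter> ball 0 (real j))" .
    moreover have "at z within S \<inter> ball 0 (real j) = at z within S"
      by (rule at_within_nhd[of _ "ball 0 (real j)"]) (use elim in auto)
    ultimately show ?case by simp
  qed
  have "z \<in> closure S" "z \<notin> S"
    using normal S by (auto simp: outer_normal_def frontier_def interior_open)
  then have nt: "at z within S \<noteq> bot"
    by (simp add: trivial_limit_within closure_def)
  obtain j\<^sub>0 where j0: "\<And>j. j \<ge> j\<^sub>0 \<Longrightarrow> ((\<lambda>w. F w \<nu>) \<longlongrightarrow> l j) (at z within S)"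
    using ev by (auto simp: eventually_sequentially)
  have "l j = l j\<^sub>0" if "j \<ge> j\<^sub>0" for j
    using tendsto_unique[OF nt j0[OF that] j0[OF order_refl]] .
  then have "l \<longlonglongrightarrow> l j\<^sub>0"
    by (intro tendsto_eventually eventually_sequentiallyI[of j\<^sub>0])
  then have "l j\<^sub>0 = 0" using l LIMSEQ_unique by blast
  then show ?thesis using j0[of j\<^sub>0] by simp
qed

text \<open>Two choices of \<open>p\<close> matter: \<open>x\<close> and \<open>y\<close>, which give the two components of \<open>\<rho> \<Phi> \<nu>\<close>.\<close>

lemma flux_1x1:
  assumes "\<Phi> \<in> carrier_mat 2 2"
  shows "flux \<rho> \<Phi> (Matrix.mat 1 1 (\<lambda>_. p)) w \<nu> $$ (0, 0) =
    \<rho> w * ((eval (\<Phi> $$ (0, 0)) w * eval (dx p) w + eval (\<Phi> $$ (0, 1)) w * eval (dy p) w) * fst \<nu> +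
      (eval (\<Phi> $$ (1, 0)) w * eval (dx p) w + eval (\<Phi> $$ (1, 1)) w * eval (dy p) w) * snd \<nu>)"
  using assms
  by (simp add: flux_def Let_def eval_mat_def grad_def append_rows_def scalar_prod_def numeral_2_eq_2 algebra_simps)

section \<open>A divergence theorem with an exhaustion function\<close>

text \<open>The derivative need not be continuous: on each line the gauge integral version of the fundamental theorem
of calculus applies, and integrability in the plane is enough for Fubini's theorem.\<close>

lemma integral_dx_eq_0:
  fixes G F :: "real \<times> real \<Rightarrow> real"
  assumes F: "integrable lborel F" and der: "\<And>z. has_dx G (F z) z"
    and K: "bounded K" "\<And>z. z \<notin> K \<Longrightarrow> F z = 0" "\<And>z. z \<notin> K \<Longrightarrow> G z = 0"
  shows "integral\<^sup>L lborel F = 0"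
proof -
  obtain B where B: "\<And>z. z \<in> K \<Longrightarrow> norm z < B" "B > 0"
    using K(1) unfolding bounded_pos_less by auto
  have out: "(x, y) \<notin> K" if "\<bar>x\<bar> \<ge> B" for x y
    using B(1)[of "(x, y)"] norm_fst_le[of x y] that by auto
  have inner0: "(\<integral>x. F (x, y) \<partial>lborel) = 0" for y
  proof (cases "integrable lborel (\<lambda>x. F (x, y))")
    case True
    have "((\<lambda>x. F (x, y)) has_integral (G (B, y) - G (- B, y))) {- B..B}"
    proof (rule fundamental_theorem_of_calculus)
      fix x
      have "((\<lambda>t. G (t, y)) has_real_derivative F (x, y)) (at x)"
        using der[of "(x, y)"] by (simp add: has_dx_def)
      then show "((\<lambda>t. G (t, y)) has_vector_derivative F (x, y)) (at x within {- B..B})"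
        unfolding has_real_derivative_iff_has_vector_derivative by (rule has_vector_derivative_at_within)
    qed (use B(2) in auto)
    moreover have "G (B, y) = 0" "G (- B, y) = 0" using out K(3) B(2) by auto
    ultimately have "((\<lambda>x. F (x, y)) has_integral 0) {- B..B}" by simp
    then have "((\<lambda>x. F (x, y)) has_integral 0) UNIV"
      by (rule has_integral_on_superset) (use out K(2) in \<open>auto simp: abs_le_iff\<close>)
    then show ?thesis using has_integral_integral_lborel[OF True] has_integral_unique by blast
  next
    case False
    \<comment> \<open>On the exceptional lines the Bochner integral takes its default value, again \<open>0\<close>.\<close>
    then show ?thesis by (rule not_integrable_integral_eq)
  qed
  have F': "integrable (lborel \<Otimes>\<^sub>M lborel) (\<lambda>(x, y). F (x, y))" using F by (simp add: lborel_prod)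
  have "(\<integral>y. (\<integral>x. F (x, y) \<partial>lborel) \<partial>lborel) = integral\<^sup>L (lborel \<Otimes>\<^sub>M lborel) (\<lambda>(x, y). F (x, y))"
    by (rule lborel_pair.integral_snd) (use F' in auto)
  then show ?thesis by (simp add: inner0 lborel_prod)
qed

lemma integral_dy_eq_0:
  fixes G F :: "real \<times> real \<Rightarrow> real"
  assumes F: "integrable lborel F" and der: "\<And>z. has_dy G (F z) z"
    and K: "bounded K" "\<And>z. z \<notin> K \<Longrightarrow> F z = 0" "\<And>z. z \<notin> K \<Longrightarrow> G z = 0"
  shows "integral\<^sup>L lborel F = 0"
proof -
  let ?s = "prod.swap :: real \<times> real \<Rightarrow> real \<times> real"
  have F': "integrable (lborel \<Otimes>\<^sub>M lborel) F" using F by (simp add: lborel_prod)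
  have i: "integrable lborel (\<lambda>(x, y). F (y, x))"
    using lborel_pair.integrable_product_swap[OF F'] by (simp add: lborel_prod)
  have "integral\<^sup>L lborel (\<lambda>(x, y). F (y, x)) = 0"
  proof (rule integral_dx_eq_0[OF i, of "\<lambda>(x, y). G (y, x)" "?s ` K"])
    show "has_dx (\<lambda>(x, y). G (y, x)) (case z of (x, y) \<Rightarrow> F (y, x)) z" for z
      using der[of "(snd z, fst z)"] by (cases z) (simp add: has_dx_def has_dy_def)
    obtain B where "\<And>z. z \<in> K \<Longrightarrow> norm z \<le> B" using K(1) unfolding bounded_iff by auto
    then show "bounded (?s ` K)"
      unfolding bounded_iff by (force simp: norm_prod_def add.commute)
    show "(case z of (x, y) \<Rightarrow> F (y, x)) = 0" "(case z of (x, y) \<Rightarrow> G (y, x)) = 0"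
      if "z \<notin> ?s ` K" for z
    proof -
      have "(snd z, fst z) \<notin> K"
        using that by (metis image_eqI prod.collapse swap_simp)
      then show "(case z of (x, y) \<Rightarrow> F (y, x)) = 0" "(case z of (x, y) \<Rightarrow> G (y, x)) = 0"
        using K by (auto split: prod.split)
    qed
  qed
  moreover have "integral\<^sup>L (lborel \<Otimes>\<^sub>M lborel) (\<lambda>(x, y). F (y, x)) = integral\<^sup>L (lborel \<Otimes>\<^sub>M lborel) F"
    by (rule lborel_pair.integral_product_swap) (use F' in auto)
  ultimately show ?thesis by (simp add: lborel_prod)
qed

lemma DERIV_pos_part_square:
  "((\<lambda>s::real. (max 0 s)\<^sup>2) has_real_derivative 2 * max 0 s) (at s)"
proof -
  consider "s > 0" | "s < 0" | "s = 0" by linarith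
  then show ?thesis
  proof cases
    case 1
    have "((\<lambda>s::real. s\<^sup>2) has_real_derivative 2 * max 0 s) (at s)"
      using 1 by (auto intro!: derivative_eq_intros)
    then show ?thesis
      by (rule has_field_derivative_transform_within_open[of _ _ _ "{0<..}"]) (use 1 in auto)
  next
    case 2
    have "((\<lambda>s::real. 0) has_real_derivative 2 * max 0 s) (at s)"
      using 2 by auto
    then show ?thesis
      by (rule has_field_derivative_transform_within_open[of _ _ _ "{..<0}"]) (use 2 in auto)
  next
    case 3
    have "((\<lambda>h::real. ((max 0 (0 + h))\<^sup>2 - (max 0 0)\<^sup>2) / h) \<longlongrightarrow> 0) (at 0)"
    proof (rule Lim_null_comparison)
      show "\<forall>\<^sub>F h::real in at 0. norm (((max 0 (0 + h))\<^sup>2 - (max 0 0)\<^sup>2) / h) \<le> \<bar>h\<bar>"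
        by (rule always_eventually) (auto simp: max_def power2_eq_square)
      show "((\<lambda>h::real. \<bar>h\<bar>) \<longlongrightarrow> 0) (at 0)"
        by (rule tendsto_eq_intros refl | simp)+
    qed
    then show ?thesis unfolding DERIV_def 3 by simp
  qed
qed

text \<open>Squaring the positive part gives the cutoff a continuous derivative, so that no smooth bump function has to
be constructed.\<close>

lemma DERIV_cutoff:
  fixes f :: "real \<Rightarrow> real"
  assumes "(f has_real_derivative f') (at x)"
  shows "((\<lambda>t. (max 0 (1 - e * f t))\<^sup>2) has_real_derivative - 2 * e * f' * max 0 (1 - e * f x)) (at x)"
proof -
  have "((\<lambda>t. 1 - e * f t) has_real_derivative - e * f') (at x)"
    by (rule derivative_eq_intros assms refl | simp)+
  from DERIV_chain2[OF DERIV_pos_part_square this] show ?thesis by (simp add: mult_ac)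
qed

lemma has_dx_cutoff:
  assumes "open \<Omega>" "z \<in> \<Omega>" "has_dx F Fx z" "has_dx q qx z"
  shows "has_dx (\<lambda>w. if w \<in> \<Omega> then (max 0 (1 - e * q w))\<^sup>2 * F w else 0)
     ((max 0 (1 - e * q z))\<^sup>2 * Fx - 2 * e * qx * max 0 (1 - e * q z) * F z) z"
proof -
  have "((\<lambda>t. (max 0 (1 - e * q (t, snd z)))\<^sup>2 * F (t, snd z)) has_real_derivative
      ((max 0 (1 - e * q z))\<^sup>2 * Fx - 2 * e * qx * max 0 (1 - e * q z) * F z)) (at (fst z))"
    using DERIV_mult[OF DERIV_cutoff[OF assms(4)[unfolded has_dx_def], of e] assms(3)[unfolded has_dx_def]]
    by (simp add: algebra_simps)
  then show ?thesis unfolding has_dx_def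
    by (rule has_field_derivative_transform_within_open[of _ _ _ "(\<lambda>t. (t, snd z)) -` \<Omega>"])
      (use assms in \<open>auto intro!: open_vimage continuous_intros\<close>)
qed

lemma has_dy_cutoff:
  assumes "open \<Omega>" "z \<in> \<Omega>" "has_dy F Fy z" "has_dy q qy z"
  shows "has_dy (\<lambda>w. if w \<in> \<Omega> then (max 0 (1 - e * q w))\<^sup>2 * F w else 0)
     ((max 0 (1 - e * q z))\<^sup>2 * Fy - 2 * e * qy * max 0 (1 - e * q z) * F z) z"
proof -
  have "((\<lambda>t. (max 0 (1 - e * q (fst z, t)))\<^sup>2 * F (fst z, t)) has_real_derivative
      ((max 0 (1 - e * q z))\<^sup>2 * Fy - 2 * e * qy * max 0 (1 - e * q z) * F z)) (at (snd z))"
    using DERIV_mult[OF DERIV_cutoff[OF assms(4)[unfolded has_dy_def], of e] assms(3)[unfolded has_dy_def]]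
    by (simp add: algebra_simps)
  then show ?thesis unfolding has_dy_def
    by (rule has_field_derivative_transform_within_open[of _ _ _ "(\<lambda>t. (fst z, t)) -` \<Omega>"])
      (use assms in \<open>auto intro!: open_vimage continuous_intros\<close>)
qed

lemma has_dx_locally_0:
  assumes "open S" "z \<in> S" "\<And>w. w \<in> S \<Longrightarrow> G w = 0" shows "has_dx G 0 z"
proof -
  have "((\<lambda>t::real. 0::real) has_real_derivative 0) (at (fst z))" by simp
  then show ?thesis unfolding has_dx_def
    by (rule has_field_derivative_transform_within_open[of _ _ _ "(\<lambda>t. (t, snd z)) -` S"])
      (use assms in \<open>auto intro!: open_vimage continuous_intros\<close>)
qed

lemma has_dy_locally_0:
  assumes "open S" "z \<in> S" "\<And>w. w \<in> S \<Longrightarrow> G w = 0" shows "has_dy G 0 z"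
proof -
  have "((\<lambda>t::real. 0::real) has_real_derivative 0) (at (snd z))" by simp
  then show ?thesis unfolding has_dy_def
    by (rule has_field_derivative_transform_within_open[of _ _ _ "(\<lambda>t. (fst z, t)) -` S"])
      (use assms in \<open>auto intro!: open_vimage continuous_intros\<close>)
qed

text \<open>A divergence theorem without boundary term and without regularity of the boundary. The role of the boundary
condition is played by an exhaustion function \<open>q\<close> whose derivative along the field grows at most like \<open>q\<close> itself,
up to an integrable factor. This is the borderline growth: on the support of the cutoff
\<open>(max 0 (1 - \<epsilon> q))\<^sup>2\<close> one has \<open>\<epsilon> q \<le> 1\<close>, so the gradient of the cutoff contributes at most a constant times
the integrable factor, uniformly in \<open>\<epsilon>\<close>.\<close>

lemma integral_divergence_eq_0:
  fixes \<Omega> :: "(real \<times> real) set" and F\<^sub>1 F\<^sub>2 F\<^sub>1x F\<^sub>2y q qx qy H :: "real \<times> real \<Rightarrow> real"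
  assumes \<Omega>: "open \<Omega>"
    and F1: "\<And>z. z \<in> \<Omega> \<Longrightarrow> has_dx F\<^sub>1 (F\<^sub>1x z) z" and F2: "\<And>z. z \<in> \<Omega> \<Longrightarrow> has_dy F\<^sub>2 (F\<^sub>2y z) z"
    and qx: "\<And>z. z \<in> \<Omega> \<Longrightarrow> has_dx q (qx z) z" and qy: "\<And>z. z \<in> \<Omega> \<Longrightarrow> has_dy q (qy z) z"
    and cont: "continuous_on \<Omega> F\<^sub>1" "continuous_on \<Omega> F\<^sub>2" "continuous_on \<Omega> F\<^sub>1x" "continuous_on \<Omega> F\<^sub>2y"
      "continuous_on \<Omega> q" "continuous_on \<Omega> qx" "continuous_on \<Omega> qy"
    and exhaust: "\<And>c. compact {z \<in> \<Omega>. q z \<le> c}" and q_nonneg: "\<And>z. z \<in> \<Omega> \<Longrightarrow> q z \<ge> 0"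
    and div_integrable: "set_integrable lebesgue \<Omega> (\<lambda>z. F\<^sub>1x z + F\<^sub>2y z)"
    and H: "set_integrable lebesgue \<Omega> H"
    and slow: "\<And>z. z \<in> \<Omega> \<Longrightarrow> \<bar>F\<^sub>1 z * qx z + F\<^sub>2 z * qy z\<bar> \<le> (q z + 1) * H z"
  shows "(LINT z:\<Omega>|lebesgue. F\<^sub>1x z + F\<^sub>2y z) = 0"
proof -
  define e :: "nat \<Rightarrow> real" where "e n = 1 / (real n + 1)" for n
  define m where "m n z = max 0 (1 - e n * q z)" for n z
  \<comment> \<open>\<open>T\<close> is the partial derivative of a component of the field times the cutoff.\<close>
  define T where "T n F F' q' z = (m n z)\<^sup>2 * F' z - 2 * e n * q' z * m n z * F z"
    for n F F' q' and z :: "real \<times> real"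
  let ?D = "\<lambda>n F F' q' z. if z \<in> \<Omega> then T n F F' q' z else 0"
  have e: "0 < e n" "e n \<le> 1" for n by (auto simp: e_def)
  \<comment> \<open>The cutoff vanishes off \<open>K n\<close>, so extending the truncated field by zero creates no jump at the boundary.\<close>
  define K where "K n = {z \<in> \<Omega>. q z \<le> 1 / e n}" for n
  have m0: "m n z = 0" if "z \<in> \<Omega>" "z \<notin> K n" for n z
    using that e[of n] by (auto simp: K_def m_def divide_simps mult.commute)
  have openK: "open (- K n)" for n
    using exhaust[of "1 / e n"] by (simp add: K_def compact_imp_closed open_Compl)
  have bK: "bounded (K n)" for n
    using exhaust[of "1 / e n"] by (simp add: K_def compact_imp_bounded)
  have intD: "integrable lborel (?D n F F' q')"
    if "continuous_on \<Omega> F" "continuous_on \<Omega> F'" "continuous_on \<Omega> q'" for n F F' q'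
  proof -
    have "continuous_on \<Omega> (T n F F' q')"
      unfolding T_def m_def by (intro continuous_intros that cont)
    then have "continuous_on (K n) (T n F F' q')"
      by (rule continuous_on_subset) (auto simp: K_def)
    then have "integrable lborel (\<lambda>z. indicator (K n) z *\<^sub>R T n F F' q' z)"
      by (rule borel_integrable_compact[rotated]) (use exhaust in \<open>simp add: K_def\<close>)
    moreover have "(\<lambda>z. indicator (K n) z *\<^sub>R T n F F' q' z) = ?D n F F' q'"
    proof
      fix z show "indicator (K n) z *\<^sub>R T n F F' q' z = ?D n F F' q' z"
        using m0[of z n] by (cases "z \<in> K n") (auto simp: T_def K_def)
    qed
    ultimately show ?thesis by simp
  qed
  have int0: "integral\<^sup>L lborel (?D n F\<^sub>1 F\<^sub>1x qx) = 0" for n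
  proof (rule integral_dx_eq_0[where K = "K n"])
    show "integrable lborel (?D n F\<^sub>1 F\<^sub>1x qx)" by (intro intD cont)
    show "?D n F\<^sub>1 F\<^sub>1x qx z = 0" "(if z \<in> \<Omega> then (m n z)\<^sup>2 * F\<^sub>1 z else 0) = 0" if "z \<notin> K n" for z
      using m0 that by (auto simp: T_def)
    show "has_dx (\<lambda>w. if w \<in> \<Omega> then (m n w)\<^sup>2 * F\<^sub>1 w else 0) (?D n F\<^sub>1 F\<^sub>1x qx z) z" for z
    proof (cases "z \<in> \<Omega>")
      case True
      then show ?thesis
        using has_dx_cutoff[OF \<Omega> True F1[OF True] qx[OF True], of "e n"] unfolding m_def T_def by simp
    next
      case False
      then show ?thesis
        using has_dx_locally_0[OF openK[of n], of z] m0 by (auto simp: K_def)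
    qed
  qed (rule bK)
  have int0': "integral\<^sup>L lborel (?D n F\<^sub>2 F\<^sub>2y qy) = 0" for n
  proof (rule integral_dy_eq_0[where K = "K n"])
    show "integrable lborel (?D n F\<^sub>2 F\<^sub>2y qy)" by (intro intD cont)
    show "?D n F\<^sub>2 F\<^sub>2y qy z = 0" "(if z \<in> \<Omega> then (m n z)\<^sup>2 * F\<^sub>2 z else 0) = 0" if "z \<notin> K n" for z
      using m0 that by (auto simp: T_def)
    show "has_dy (\<lambda>w. if w \<in> \<Omega> then (m n w)\<^sup>2 * F\<^sub>2 w else 0) (?D n F\<^sub>2 F\<^sub>2y qy z) z" for z
    proof (cases "z \<in> \<Omega>")
      case True
      then show ?thesis
        using has_dy_cutoff[OF \<Omega> True F2[OF True] qy[OF True], of "e n"] unfolding m_def T_def by simp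
    next
      case False
      then show ?thesis
        using has_dy_locally_0[OF openK[of n], of z] m0 by (auto simp: K_def)
    qed
  qed (rule bK)
  define S where "S n z = ?D n F\<^sub>1 F\<^sub>1x qx z + ?D n F\<^sub>2 F\<^sub>2y qy z" for n z
  have intS: "integrable lborel (S n)" for n
    unfolding S_def by (intro Bochner_Integration.integrable_add intD cont)
  have "integral\<^sup>L lborel (S n) = 0" for n
    unfolding S_def using int0[of n] int0'[of n] by (subst Bochner_Integration.integral_add) (auto intro: intD cont)
  then have S0: "integral\<^sup>L lebesgue (S n) = 0" for n
    using intS[of n] by (subst integral_completion) auto
  have "(\<lambda>n. integral\<^sup>L lebesgue (S n)) \<longlonglongrightarrow>
      (\<integral>z. indicator \<Omega> z *\<^sub>R (F\<^sub>1x z + F\<^sub>2y z) \<partial>lebesgue)"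
  proof (rule integral_dominated_convergence)
    show "integrable lebesgue (\<lambda>z. \<bar>indicator \<Omega> z *\<^sub>R (F\<^sub>1x z + F\<^sub>2y z)\<bar> + 4 * (indicator \<Omega> z *\<^sub>R H z))"
      using div_integrable H unfolding set_integrable_def by (intro Bochner_Integration.integrable_add integrable_abs integrable_mult_right)
    show "(\<lambda>z. indicator \<Omega> z *\<^sub>R (F\<^sub>1x z + F\<^sub>2y z)) \<in> borel_measurable lebesgue"
      using div_integrable unfolding set_integrable_def by (rule borel_measurable_integrable)
    show "S n \<in> borel_measurable lebesgue" for n
      using intS[of n] by (intro measurable_completion) auto
    have Seq: "S n z = (m n z)\<^sup>2 * (F\<^sub>1x z + F\<^sub>2y z) - 2 * e n * m n z * (F\<^sub>1 z * qx z + F\<^sub>2 z * qy z)"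
      if "z \<in> \<Omega>" for n z
      using that by (simp add: S_def T_def algebra_simps)
    show "AE z in lebesgue. (\<lambda>n. S n z) \<longlonglongrightarrow> indicator \<Omega> z *\<^sub>R (F\<^sub>1x z + F\<^sub>2y z)"
    proof (rule AE_I2)
      fix z
      have e0: "e \<longlonglongrightarrow> 0" unfolding e_def using LIMSEQ_inverse_real_of_nat
        by (simp add: inverse_eq_divide add.commute)
      have m1: "(\<lambda>n. m n z) \<longlonglongrightarrow> 1"
        unfolding m_def by (rule tendsto_eq_intros e0 refl | simp)+
      have "(\<lambda>n. (m n z)\<^sup>2 * (F\<^sub>1x z + F\<^sub>2y z) - 2 * e n * m n z * (F\<^sub>1 z * qx z + F\<^sub>2 z * qy z))
          \<longlonglongrightarrow> F\<^sub>1x z + F\<^sub>2y z"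
        by (rule tendsto_eq_intros e0 m1 refl | simp)+
      then show "(\<lambda>n. S n z) \<longlonglongrightarrow> indicator \<Omega> z *\<^sub>R (F\<^sub>1x z + F\<^sub>2y z)"
        by (cases "z \<in> \<Omega>") (simp_all add: Seq, simp add: S_def)
    qed
    show "AE z in lebesgue. norm (S n z)
        \<le> \<bar>indicator \<Omega> z *\<^sub>R (F\<^sub>1x z + F\<^sub>2y z)\<bar> + 4 * (indicator \<Omega> z *\<^sub>R H z)" for n
    proof (rule AE_I2)
      fix z
      show "norm (S n z) \<le> \<bar>indicator \<Omega> z *\<^sub>R (F\<^sub>1x z + F\<^sub>2y z)\<bar> + 4 * (indicator \<Omega> z *\<^sub>R H z)"
      proof (cases "z \<in> \<Omega>")
        case True
        have q: "q z \<ge> 0" by (rule q_nonneg[OF True])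
        have m: "0 \<le> m n z" "m n z \<le> 1" using q e[of n] by (auto simp: m_def)
        have H0: "H z \<ge> 0" using slow[OF True] q
          by (smt (verit) zero_le_mult_iff)
        \<comment> \<open>Where the cutoff is nonzero, \<open>e n * q z < 1\<close>; adding \<open>e n \<le> 1\<close> gives the bound 2.\<close>
        have meq: "m n z * (e n * (q z + 1)) \<le> 2"
        proof (cases "m n z = 0")
          case False
          then have "e n * (q z + 1) \<le> 2" using e[of n] by (auto simp: m_def distrib_left split: if_splits)
          moreover have "0 \<le> e n * (q z + 1)" using e[of n] q by simp
          ultimately show ?thesis using mult_mono[OF m(2), of "e n * (q z + 1)" 2] by simp
        qed simp
        have "\<bar>2 * e n * m n z * (F\<^sub>1 z * qx z + F\<^sub>2 z * qy z)\<bar> = 2 * e n * m n z * \<bar>F\<^sub>1 z * qx z + F\<^sub>2 z * qy z\<bar>"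
          using m e[of n] by (simp add: abs_mult)
        also have "\<dots> \<le> 2 * e n * m n z * ((q z + 1) * H z)"
          using m e[of n] by (intro mult_left_mono slow[OF True]) auto
        also have "\<dots> = 2 * (m n z * (e n * (q z + 1))) * H z" by simp
        also have "\<dots> \<le> 2 * 2 * H z"
          by (intro mult_right_mono mult_left_mono meq H0) auto
        finally have "\<bar>2 * e n * m n z * (F\<^sub>1 z * qx z + F\<^sub>2 z * qy z)\<bar> \<le> 4 * H z" by simp
        moreover have "\<bar>(m n z)\<^sup>2 * (F\<^sub>1x z + F\<^sub>2y z)\<bar> \<le> \<bar>F\<^sub>1x z + F\<^sub>2y z\<bar>"
          using m by (simp add: abs_mult mult_left_le_one_le power_le_one)
        ultimately show ?thesis using True by (simp add: Seq) 
      qed (simp add: S_def)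
    qed
  qed
  then have "(\<integral>z. indicator \<Omega> z *\<^sub>R (F\<^sub>1x z + F\<^sub>2y z) \<partial>lebesgue) = 0"
    unfolding S0 using LIMSEQ_unique tendsto_const by blast
  then show ?thesis unfolding set_lebesgue_integral_def .
qed

section \<open>Weights with commuting columns\<close>

text \<open>The analytic content of the notion of a classical weight, for \<open>\<Phi> = (a b; b c)\<close>. The two commutation identities
are the nontrivial entries of the compatibility condition; they say that the columns of \<open>\<Phi>\<close>, as vector
fields, commute. The boundary conditions are the two components of \<open>\<rho> \<Phi> \<nu> \<rightarrow> 0\<close>.\<close>

locale pearson_weight =
  fixes \<Omega> :: "(real \<times> real) set" and \<rho> :: "real \<times> real \<Rightarrow> real" and a b c \<psi>\<^sub>1 \<psi>\<^sub>2 :: bipoly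
  assumes open_\<Omega>: "open \<Omega>" and connected_\<Omega>: "connected \<Omega>"
    and a_pos: "z \<in> \<Omega> \<Longrightarrow> eval a z > 0" and c_pos: "z \<in> \<Omega> \<Longrightarrow> eval c z > 0"
    and det_pos: "z \<in> \<Omega> \<Longrightarrow> eval a z * eval c z - eval b z * eval b z > 0"
    and \<rho>_nonneg: "z \<in> \<Omega> \<Longrightarrow> \<rho> z \<ge> 0" and \<rho>_nontrivial: "\<exists>z\<in>\<Omega>. \<rho> z \<noteq> 0"
    and pearson\<^sub>1: "z \<in> \<Omega> \<Longrightarrow> \<exists>d e. has_dx (\<lambda>w. \<rho> w * eval a w) d z \<and>
      has_dy (\<lambda>w. \<rho> w * eval b w) e z \<and> d + e = \<rho> z * eval \<psi>\<^sub>1 z"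
    and pearson\<^sub>2: "z \<in> \<Omega> \<Longrightarrow> \<exists>d e. has_dx (\<lambda>w. \<rho> w * eval b w) d z \<and>
      has_dy (\<lambda>w. \<rho> w * eval c w) e z \<and> d + e = \<rho> z * eval \<psi>\<^sub>2 z"
    and commute\<^sub>b: "a * dx b + b * dy b = b * dx a + c * dy a"
    and commute\<^sub>c: "a * dx c + b * dy c = b * dx b + c * dy b"
    and moments: "set_integrable lebesgue \<Omega> (\<lambda>z. eval p z * \<rho> z)"
    and normals: "has_outer_normals \<Omega>"
    and boundary\<^sub>1: "outer_normal \<Omega> z \<nu> \<Longrightarrow>
      ((\<lambda>w. \<rho> w * (eval a w * fst \<nu> + eval b w * snd \<nu>)) \<longlongrightarrow> 0) (at z within \<Omega>)"
    and boundary\<^sub>2: "outer_normal \<Omega> z \<nu> \<Longrightarrow>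
      ((\<lambda>w. \<rho> w * (eval b w * fst \<nu> + eval c w * snd \<nu>)) \<longlongrightarrow> 0) (at z within \<Omega>)"
begin

definition D :: "real \<times> real \<Rightarrow> real" where "D z = eval a z * eval c z - eval b z * eval b z"

definition Dx :: "real \<times> real \<Rightarrow> real" where
  "Dx z = eval (dx a) z * eval c z + eval (dx c) z * eval a z - 2 * eval b z * eval (dx b) z"

definition Dy :: "real \<times> real \<Rightarrow> real" where
  "Dy z = eval (dy a) z * eval c z + eval (dy c) z * eval a z - 2 * eval b z * eval (dy b) z"

text \<open>Pearson's equation reads \<open>\<Phi> \<nabla>\<rho> = \<rho> (\<eta>\<^sub>1, \<eta>\<^sub>2)\<close>. Its solution by Cramer's rule is \<open>\<nabla>\<rho> = \<rho> (\<alpha>, \<beta>)\<close>.\<close>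

definition \<eta>\<^sub>1 :: "real \<times> real \<Rightarrow> real" where "\<eta>\<^sub>1 z = eval \<psi>\<^sub>1 z - (eval (dx a) z + eval (dy b) z)"

definition \<eta>\<^sub>2 :: "real \<times> real \<Rightarrow> real" where "\<eta>\<^sub>2 z = eval \<psi>\<^sub>2 z - (eval (dx b) z + eval (dy c) z)"

definition \<alpha> :: "real \<times> real \<Rightarrow> real" where "\<alpha> z = (eval c z * \<eta>\<^sub>1 z - eval b z * \<eta>\<^sub>2 z) / D z"

definition \<beta> :: "real \<times> real \<Rightarrow> real" where "\<beta> z = (eval a z * \<eta>\<^sub>2 z - eval b z * \<eta>\<^sub>1 z) / D z"

lemma D_pos: "z \<in> \<Omega> \<Longrightarrow> D z > 0"
  using det_pos by (simp add: D_def)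

lemma has_dx_D: "has_dx D (Dx z) z"
proof -
  have "((\<lambda>t. eval a (t, snd z) * eval c (t, snd z) - eval b (t, snd z) * eval b (t, snd z))
      has_real_derivative Dx z) (at (fst z))"
    by (rule derivative_eq_intros has_dx_eval[unfolded has_dx_def] refl | simp add: Dx_def)+
  then show ?thesis by (simp add: has_dx_def D_def)
qed

lemma has_dy_D: "has_dy D (Dy z) z"
proof -
  have "((\<lambda>t. eval a (fst z, t) * eval c (fst z, t) - eval b (fst z, t) * eval b (fst z, t))
      has_real_derivative Dy z) (at (snd z))"
    by (rule derivative_eq_intros has_dy_eval[unfolded has_dy_def] refl | simp add: Dy_def)+
  then show ?thesis by (simp add: has_dy_def D_def)
qed

lemma continuous_on_D [continuous_intros]: "continuous_on S D" "continuous_on S Dx" "continuous_on S Dy"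
  unfolding D_def Dx_def Dy_def by (intro continuous_intros)+

lemma continuous_on_\<alpha>\<beta>:
  assumes "\<And>z. z \<in> S \<Longrightarrow> D z \<noteq> 0"
  shows "continuous_on S \<alpha>" "continuous_on S \<beta>"
  unfolding \<alpha>_def \<beta>_def \<eta>\<^sub>1_def \<eta>\<^sub>2_def using assms by (auto intro!: continuous_intros)

lemma \<alpha>\<beta>_solve:
  assumes "D z \<noteq> 0"
  shows "eval a z * \<alpha> z + eval b z * \<beta> z = \<eta>\<^sub>1 z" "eval b z * \<alpha> z + eval c z * \<beta> z = \<eta>\<^sub>2 z"
proof -
  have *: "D z * \<alpha> z = eval c z * \<eta>\<^sub>1 z - eval b z * \<eta>\<^sub>2 z" "D z * \<beta> z = eval a z * \<eta>\<^sub>2 z - eval b z * \<eta>\<^sub>1 z"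
    using assms by (simp_all add: \<alpha>_def \<beta>_def)
  have "D z * (eval a z * \<alpha> z + eval b z * \<beta> z) = eval a z * (D z * \<alpha> z) + eval b z * (D z * \<beta> z)"
    "D z * (eval b z * \<alpha> z + eval c z * \<beta> z) = eval b z * (D z * \<alpha> z) + eval c z * (D z * \<beta> z)"
    by (simp_all add: algebra_simps)
  then have "D z * (eval a z * \<alpha> z + eval b z * \<beta> z) = D z * \<eta>\<^sub>1 z"
    "D z * (eval b z * \<alpha> z + eval c z * \<beta> z) = D z * \<eta>\<^sub>2 z"
    unfolding * by (simp_all add: D_def algebra_simps)
  then show "eval a z * \<alpha> z + eval b z * \<beta> z = \<eta>\<^sub>1 z" "eval b z * \<alpha> z + eval c z * \<beta> z = \<eta>\<^sub>2 z"
    using assms by simp_all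
qed

text \<open>The diagonal entries of \<open>\<Phi>\<close> are positive, so the products \<open>\<rho> a\<close> and \<open>\<rho> c\<close> yield the partial derivatives of
\<open>\<rho>\<close> in \<open>x\<close> and in \<open>y\<close> respectively.\<close>

lemma log_derivatives:
  assumes z: "z \<in> \<Omega>"
  shows "has_dx \<rho> (\<alpha> z * \<rho> z) z" "has_dy \<rho> (\<beta> z * \<rho> z) z"
proof -
  obtain d\<^sub>1 e\<^sub>1 where 1: "has_dx (\<lambda>w. \<rho> w * eval a w) d\<^sub>1 z" "has_dy (\<lambda>w. \<rho> w * eval b w) e\<^sub>1 z"
      "d\<^sub>1 + e\<^sub>1 = \<rho> z * eval \<psi>\<^sub>1 z" using pearson\<^sub>1[OF z] by blast
  obtain d\<^sub>2 e\<^sub>2 where 2: "has_dx (\<lambda>w. \<rho> w * eval b w) d\<^sub>2 z" "has_dy (\<lambda>w. \<rho> w * eval c w) e\<^sub>2 z"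
      "d\<^sub>2 + e\<^sub>2 = \<rho> z * eval \<psi>\<^sub>2 z" using pearson\<^sub>2[OF z] by blast
  obtain A where A: "has_dx \<rho> A z"
    using has_dx_cancel[OF open_\<Omega> z 1(1) has_dx_eval] a_pos by (metis less_irrefl)
  obtain B where B: "has_dy \<rho> B z"
    using has_dy_cancel[OF open_\<Omega> z 2(2) has_dy_eval] c_pos by (metis less_irrefl)
  have "d\<^sub>1 = A * eval a z + eval (dx a) z * \<rho> z" "e\<^sub>1 = B * eval b z + eval (dy b) z * \<rho> z"
    "d\<^sub>2 = A * eval b z + eval (dx b) z * \<rho> z" "e\<^sub>2 = B * eval c z + eval (dy c) z * \<rho> z"
    using has_dx_unique[OF 1(1) has_dx_mult[OF A has_dx_eval]] has_dy_unique[OF 1(2) has_dy_mult[OF B has_dy_eval]]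
      has_dx_unique[OF 2(1) has_dx_mult[OF A has_dx_eval]] has_dy_unique[OF 2(2) has_dy_mult[OF B has_dy_eval]]
    by blast+
  then have eq: "eval a z * A + eval b z * B = \<rho> z * \<eta>\<^sub>1 z" "eval b z * A + eval c z * B = \<rho> z * \<eta>\<^sub>2 z"
    using 1(3) 2(3) by (simp_all add: \<eta>\<^sub>1_def \<eta>\<^sub>2_def algebra_simps)
  have "D z * A = eval c z * (eval a z * A + eval b z * B) - eval b z * (eval b z * A + eval c z * B)"
    "D z * B = eval a z * (eval b z * A + eval c z * B) - eval b z * (eval a z * A + eval b z * B)"
    by (simp_all add: D_def algebra_simps)
  then have "A = \<alpha> z * \<rho> z" "B = \<beta> z * \<rho> z"
    unfolding eq using D_pos[OF z] by (simp_all add: \<alpha>_def \<beta>_def field_simps)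
  then show "has_dx \<rho> (\<alpha> z * \<rho> z) z" "has_dy \<rho> (\<beta> z * \<rho> z) z" using A B by auto
qed

lemma D_nonzero: "z \<in> \<Omega> \<Longrightarrow> D z \<noteq> 0"
  by (drule D_pos) simp

lemma continuous_on_\<rho>: "continuous_on \<Omega> \<rho>"
  by (rule log_differentiable_continuous_on[OF open_\<Omega> continuous_on_\<alpha>\<beta>[OF D_nonzero]
        log_derivatives \<rho>_nonneg])

lemma \<rho>_pos: assumes "z \<in> \<Omega>" shows "\<rho> z > 0"
proof -
  obtain z\<^sub>0 where z0: "z\<^sub>0 \<in> \<Omega>" "\<rho> z\<^sub>0 > 0" using \<rho>_nontrivial \<rho>_nonneg by force
  show ?thesis
    by (rule log_differentiable_pos[OF open_\<Omega> continuous_on_\<alpha>\<beta>[OF D_nonzero]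
          log_derivatives \<rho>_nonneg connected_\<Omega> z0 assms])
qed

text \<open>Where \<open>D\<close> does not vanish the vector \<open>\<Phi> \<nu>\<close> is nonzero, so \<open>\<rho> \<Phi> \<nu> \<rightarrow> 0\<close> forces \<open>\<rho> \<rightarrow> 0\<close>; but there the logarithmic
gradient of \<open>\<rho>\<close> is bounded, and \<open>\<rho>\<close> cannot tend to zero.\<close>

lemma D_eq_0_at_normal:
  assumes \<nu>: "outer_normal \<Omega> z \<nu>"
  shows "D z = 0"
proof (rule ccontr)
  assume Dz: "D z \<noteq> 0"
  have lim: "(eval p \<longlongrightarrow> eval p z) (at z within \<Omega>)" for p
  proof -
    have "isCont (eval p) z" using continuous_on_eval[of UNIV p] by (simp add: continuous_on_eq_continuous_at del: split_paired_All)
    then show ?thesis by (meson continuous_at_imp_continuous_at_within continuous_within)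
  qed
  have limD: "(D \<longlongrightarrow> D z) (at z within \<Omega>)"
    unfolding D_def by (intro tendsto_intros lim)
  obtain n m where nm: "\<nu> = (n, m)" by fastforce
  have unit: "n * n + m * m = 1" using \<nu> by (simp add: outer_normal_def nm norm_prod_def power2_eq_square)
  let ?f = "\<lambda>w. \<rho> w * (eval a w * n + eval b w * m)" and ?g = "\<lambda>w. \<rho> w * (eval b w * n + eval c w * m)"
  have fg: "(?f \<longlongrightarrow> 0) (at z within \<Omega>)" "(?g \<longlongrightarrow> 0) (at z within \<Omega>)"
    using boundary\<^sub>1[OF \<nu>] boundary\<^sub>2[OF \<nu>] by (simp_all add: nm)
  \<comment> \<open>\<open>\<nu> \<cdot> \<Phi>\<^sup>-\<^sup>1 (\<rho> \<Phi> \<nu>) = \<rho>\<close>, the inverse of \<open>\<Phi>\<close> being written as the adjugate over \<open>D\<close>.\<close>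
  let ?h = "\<lambda>w. (n * (eval c w * ?f w - eval b w * ?g w) + m * (eval a w * ?g w - eval b w * ?f w)) / D w"
  have "(?h \<longlongrightarrow> (n * (eval c z * 0 - eval b z * 0) + m * (eval a z * 0 - eval b z * 0)) / D z) (at z within \<Omega>)"
    by (intro tendsto_intros lim limD fg Dz)
  then have "(?h \<longlongrightarrow> 0) (at z within \<Omega>)" by simp
  moreover have "?h w = \<rho> w" if "w \<in> \<Omega>" for w
  proof -
    have "n * (eval c w * ?f w - eval b w * ?g w) + m * (eval a w * ?g w - eval b w * ?f w) = \<rho> w * (n * n + m * m) * D w"
      by (simp add: D_def algebra_simps)
    then show ?thesis using unit D_nonzero[OF that] by simp
  qed
  ultimately have "(\<rho> \<longlongrightarrow> 0) (at z within \<Omega>)"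
    by (intro Lim_transform_eventually[of ?h 0 _ \<rho>] eventually_at_topological[THEN iffD2] exI[of _ UNIV]) auto
  moreover have opn: "open {w. D w \<noteq> 0}"
    by (intro open_Collect_neq continuous_on_D continuous_on_const)
  obtain r where r: "r > 0" "\<And>w. w \<in> ball z r \<Longrightarrow> \<bar>\<alpha> w\<bar> \<le> \<bar>\<alpha> z\<bar> + 1"
    by (rule locally_bounded_ball[OF opn continuous_on_\<alpha>\<beta>(1)]) (use Dz in auto)
  obtain s where s: "s > 0" "\<And>w. w \<in> ball z s \<Longrightarrow> \<bar>\<beta> w\<bar> \<le> \<bar>\<beta> z\<bar> + 1"
    by (rule locally_bounded_ball[OF opn continuous_on_\<alpha>\<beta>(2)]) (use Dz in auto)
  have "\<not> (\<rho> \<longlongrightarrow> 0) (at z within \<Omega>)"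
    by (rule not_tendsto_0_at_outer_normal[OF \<nu>, of "min r s" \<rho> \<alpha> \<beta> "max (\<bar>\<alpha> z\<bar> + 1) (\<bar>\<beta> z\<bar> + 1)"])
      (use r s in \<open>auto simp: log_derivatives \<rho>_pos le_max_iff_disj\<close>)
  ultimately show False by blast
qed

lemma D_eq_0_on_frontier:
  assumes "z \<in> frontier \<Omega>"
  shows "D z = 0"
proof -
  have "closed {z. D z = 0}"
    using closed_vimage[of "{0}" D] continuous_on_D(1)[of UNIV] by (simp add: vimage_def)
  then have "closure {z \<in> frontier \<Omega>. \<exists>\<nu>. outer_normal \<Omega> z \<nu>} \<subseteq> {z. D z = 0}"
    by (intro closure_minimal) (auto intro: D_eq_0_at_normal)
  then show ?thesis using normals assms by (auto simp: has_outer_normals_def)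
qed

definition exhaustion :: "real \<times> real \<Rightarrow> real" where "exhaustion z = inverse (D z) + ((fst z)\<^sup>2 + (snd z)\<^sup>2)"

text \<open>Clearing the denominator turns the condition into a closed one on the closure of \<open>\<Omega>\<close>. It fails on the
boundary, where \<open>D = 0\<close>.\<close>

lemma compact_sublevel: "compact {z \<in> \<Omega>. exhaustion z \<le> k}"
proof -
  have "{z \<in> \<Omega>. exhaustion z \<le> k} = closure \<Omega> \<inter> {z. 1 \<le> D z * (k - ((fst z)\<^sup>2 + (snd z)\<^sup>2))}" (is "?L = ?R")
  proof (intro equalityI subsetI)
    fix z assume z: "z \<in> ?L"
    then show "z \<in> ?R" using D_pos[of z] closure_subset[of \<Omega>] by (auto simp: exhaustion_def field_simps)
  next
    fix z assume z: "z \<in> ?R"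
    have "z \<in> \<Omega>"
    proof (rule ccontr)
      assume "z \<notin> \<Omega>"
      then have "D z = 0" using z open_\<Omega> by (intro D_eq_0_on_frontier) (auto simp: frontier_def interior_open)
      then show False using z by simp
    qed
    then show "z \<in> ?L" using z D_pos[of z] by (auto simp: exhaustion_def field_simps)
  qed
  moreover have "closed ?R"
    by (intro closed_Int closed_closure closed_Collect_le continuous_intros)
  moreover have "bounded ?L"
    unfolding bounded_iff
  proof (intro exI ballI)
    fix z assume "z \<in> ?L"
    then have "inverse (D z) > 0" "inverse (D z) + ((fst z)\<^sup>2 + (snd z)\<^sup>2) \<le> k"
      using D_pos[of z] by (auto simp: exhaustion_def)
    then have "(fst z)\<^sup>2 + (snd z)\<^sup>2 \<le> k" by linarith
    then show "norm z \<le> sqrt k" by (simp add: norm_prod_def)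
  qed
  ultimately show ?thesis by (simp add: compact_eq_bounded_closed)
qed

lemma continuous_on_inverse_D: "continuous_on \<Omega> (\<lambda>z. inverse (D z))"
  by (rule continuous_on_inverse[OF continuous_on_D(1)]) (use D_nonzero in blast)

text \<open>Here \<open>(f, g)\<close> is a column of \<open>\<Phi>\<close>. Tangency of the field to \<open>D = 0\<close> turns its derivative of \<open>1/D\<close> into
\<open>- (div (f, g)) / D\<close>, in which one of the two factors \<open>1/D\<close> has been cancelled. This is the slow growth that
the divergence theorem above asks for.\<close>

lemma weak_pearson:
  fixes f g \<psi> p :: bipoly
  assumes row: "\<And>z. z \<in> \<Omega> \<Longrightarrow> eval f z * \<alpha> z + eval g z * \<beta> z = eval \<psi> z - (eval (dx f) z + eval (dy g) z)"
    and tangent: "\<And>z. eval f z * Dx z + eval g z * Dy z = D z * (eval (dx f) z + eval (dy g) z)"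
  shows "(LINT z:\<Omega>|lebesgue. eval (\<psi> * p + f * dx p + g * dy p) z * \<rho> z) = 0"
proof -
  define F\<^sub>1 where "F\<^sub>1 z = eval (p * f) z * \<rho> z" for z
  define F\<^sub>2 where "F\<^sub>2 z = eval (p * g) z * \<rho> z" for z
  define F\<^sub>1x where "F\<^sub>1x z = (eval (dx p) z * eval f z + eval (dx f) z * eval p z) * \<rho> z + \<alpha> z * \<rho> z * eval (p * f) z" for z
  define F\<^sub>2y where "F\<^sub>2y z = (eval (dy p) z * eval g z + eval (dy g) z * eval p z) * \<rho> z + \<beta> z * \<rho> z * eval (p * g) z" for z
  define qx where "qx z = - (inverse (D z) * Dx z * inverse (D z)) + 2 * fst z" for z
  define qy where "qy z = - (inverse (D z) * Dy z * inverse (D z)) + 2 * snd z" for z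
  define H where "H z = \<bar>eval (p * (dx f + dy g)) z * \<rho> z\<bar> + 2 * \<bar>eval (p * (f * varx + g * vary)) z * \<rho> z\<bar>" for z
  have div: "F\<^sub>1x z + F\<^sub>2y z = eval (\<psi> * p + f * dx p + g * dy p) z * \<rho> z" if "z \<in> \<Omega>" for z
  proof -
    have "F\<^sub>1x z + F\<^sub>2y z = \<rho> z * (eval (dx p) z * eval f z + eval (dy p) z * eval g z +
        eval p z * (eval (dx f) z + eval (dy g) z) + eval p z * (eval f z * \<alpha> z + eval g z * \<beta> z))"
      by (simp add: F\<^sub>1x_def F\<^sub>2y_def algebra_simps)
    then show ?thesis unfolding row[OF that] by (simp add: algebra_simps)
  qed
  have set_cong: "set_integrable lebesgue \<Omega> u \<longleftrightarrow> set_integrable lebesgue \<Omega> v"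
    if "\<And>z. z \<in> \<Omega> \<Longrightarrow> u z = v z" for u v :: "real \<times> real \<Rightarrow> real"
    using that by (intro set_integrable_cong) auto
  have "(LINT z:\<Omega>|lebesgue. F\<^sub>1x z + F\<^sub>2y z) = 0"
  proof (rule integral_divergence_eq_0[where q = exhaustion and qx = qx and qy = qy and H = H and F\<^sub>1 = F\<^sub>1 and F\<^sub>2 = F\<^sub>2])
    show "has_dx F\<^sub>1 (F\<^sub>1x z) z" if "z \<in> \<Omega>" for z
      using has_dx_mult[OF has_dx_mult[OF has_dx_eval[of p] has_dx_eval[of f]] log_derivatives(1)[OF that]]
      by (simp add: F\<^sub>1_def[abs_def] F\<^sub>1x_def)
    show "has_dy F\<^sub>2 (F\<^sub>2y z) z" if "z \<in> \<Omega>" for z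
      using has_dy_mult[OF has_dy_mult[OF has_dy_eval[of p] has_dy_eval[of g]] log_derivatives(2)[OF that]]
      by (simp add: F\<^sub>2_def[abs_def] F\<^sub>2y_def)
    show "has_dx exhaustion (qx z) z" if "z \<in> \<Omega>" for z
    proof -
      have "((\<lambda>t. inverse (D (t, snd z)) + (t\<^sup>2 + (snd z)\<^sup>2)) has_real_derivative qx z) (at (fst z))"
        unfolding qx_def
        by (rule derivative_eq_intros has_dx_D[unfolded has_dx_def] refl | use D_nonzero[OF that] in simp)+
      then show ?thesis by (simp add: has_dx_def exhaustion_def)
    qed
    show "has_dy exhaustion (qy z) z" if "z \<in> \<Omega>" for z
    proof -
      have "((\<lambda>t. inverse (D (fst z, t)) + ((fst z)\<^sup>2 + t\<^sup>2)) has_real_derivative qy z) (at (snd z))"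
        unfolding qy_def
        by (rule derivative_eq_intros has_dy_D[unfolded has_dy_def] refl | use D_nonzero[OF that] in simp)+
      then show ?thesis by (simp add: has_dy_def exhaustion_def)
    qed
    note cont = continuous_on_\<rho> continuous_on_\<alpha>\<beta>[OF D_nonzero] continuous_on_inverse_D
    show "continuous_on \<Omega> F\<^sub>1" unfolding F\<^sub>1_def by (intro continuous_on_mult cont continuous_on_eval)
    show "continuous_on \<Omega> F\<^sub>2" unfolding F\<^sub>2_def by (intro continuous_on_mult cont continuous_on_eval)
    show "continuous_on \<Omega> F\<^sub>1x" unfolding F\<^sub>1x_def
      by (intro continuous_on_add continuous_on_mult cont continuous_on_eval)
    show "continuous_on \<Omega> F\<^sub>2y" unfolding F\<^sub>2y_def
      by (intro continuous_on_add continuous_on_mult cont continuous_on_eval)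
    show "continuous_on \<Omega> exhaustion" unfolding exhaustion_def
      by (intro continuous_on_add continuous_on_power continuous_on_fst continuous_on_snd continuous_on_id cont)
    show "continuous_on \<Omega> qx" unfolding qx_def
      by (intro continuous_on_add continuous_on_minus continuous_on_mult continuous_on_const continuous_on_fst
          continuous_on_id cont continuous_on_D)
    show "continuous_on \<Omega> qy" unfolding qy_def
      by (intro continuous_on_add continuous_on_minus continuous_on_mult continuous_on_const continuous_on_snd
          continuous_on_id cont continuous_on_D)
    show "compact {z \<in> \<Omega>. exhaustion z \<le> k}" for k by (rule compact_sublevel)
    show q0: "exhaustion z \<ge> 0" if "z \<in> \<Omega>" for z using D_pos[OF that] by (simp add: exhaustion_def)
    show "set_integrable lebesgue \<Omega> (\<lambda>z. F\<^sub>1x z + F\<^sub>2y z)"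
      using moments[of "\<psi> * p + f * dx p + g * dy p"] set_cong[OF div] by simp
    show "set_integrable lebesgue \<Omega> H"
      unfolding H_def by (intro set_integral_add set_integrable_abs set_integrable_mult_right moments)
    show "\<bar>F\<^sub>1 z * qx z + F\<^sub>2 z * qy z\<bar> \<le> (exhaustion z + 1) * H z" if z: "z \<in> \<Omega>" for z
    proof -
      let ?I = "inverse (D z)"
      have I: "?I > 0" "?I * D z = 1" using D_pos[OF z] by auto
      have "F\<^sub>1 z * qx z + F\<^sub>2 z * qy z =
          - (eval p z * \<rho> z * ?I * ?I * (eval f z * Dx z + eval g z * Dy z)) + 2 * (eval (p * (f * varx + g * vary)) z * \<rho> z)"
        by (simp add: F\<^sub>1_def F\<^sub>2_def qx_def qy_def algebra_simps)
      also have "eval p z * \<rho> z * ?I * ?I * (eval f z * Dx z + eval g z * Dy z)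
          = (?I * D z) * ?I * (eval (p * (dx f + dy g)) z * \<rho> z)"
        unfolding tangent by (simp add: algebra_simps)
      finally have "F\<^sub>1 z * qx z + F\<^sub>2 z * qy z = - (?I * (eval (p * (dx f + dy g)) z * \<rho> z)) +
          2 * (eval (p * (f * varx + g * vary)) z * \<rho> z)"
        unfolding I(2) by simp
      then have "\<bar>F\<^sub>1 z * qx z + F\<^sub>2 z * qy z\<bar> \<le> ?I * \<bar>eval (p * (dx f + dy g)) z * \<rho> z\<bar> +
          1 * (2 * \<bar>eval (p * (f * varx + g * vary)) z * \<rho> z\<bar>)"
        using I(1) abs_triangle_ineq[of "- (?I * (eval (p * (dx f + dy g)) z * \<rho> z))" "2 * (eval (p * (f * varx + g * vary)) z * \<rho> z)"]
        unfolding abs_minus_cancel abs_mult[of ?I] abs_mult[of 2] by (simp del: eval_mult eval_add)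
      also have "\<dots> \<le> (exhaustion z + 1) * \<bar>eval (p * (dx f + dy g)) z * \<rho> z\<bar> +
          (exhaustion z + 1) * (2 * \<bar>eval (p * (f * varx + g * vary)) z * \<rho> z\<bar>)"
      proof (intro add_mono mult_right_mono)
        show "?I \<le> exhaustion z + 1" by (simp add: exhaustion_def)
        show "1 \<le> exhaustion z + 1" using q0[OF z] by simp
      qed simp_all
      also have "\<dots> = (exhaustion z + 1) * H z" by (simp only: H_def distrib_left)
      finally show ?thesis .
    qed
  qed (rule open_\<Omega>)
  also have "(LINT z:\<Omega>|lebesgue. F\<^sub>1x z + F\<^sub>2y z) = (LINT z:\<Omega>|lebesgue. eval (\<psi> * p + f * dx p + g * dy p) z * \<rho> z)"
    by (rule set_lebesgue_integral_cong) (use div open_\<Omega> in auto)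
  finally show ?thesis .
qed

lemma commute_eval:
  "eval a z * eval (dx b) z + eval b z * eval (dy b) z = eval b z * eval (dx a) z + eval c z * eval (dy a) z"
  "eval a z * eval (dx c) z + eval b z * eval (dy c) z = eval b z * eval (dx b) z + eval c z * eval (dy b) z"
  using arg_cong[OF commute\<^sub>b, of "\<lambda>p. eval p z"] arg_cong[OF commute\<^sub>c, of "\<lambda>p. eval p z"] by simp_all

text \<open>The derivative of \<open>D\<close> along a column of \<open>\<Phi>\<close> contains \<open>b\<close> times a derivative of \<open>b\<close> twice; the commutation
identity is applied to only one of the two occurrences.\<close>

lemma tangent\<^sub>1: "eval a z * Dx z + eval b z * Dy z = D z * (eval (dx a) z + eval (dy b) z)"
proof -
  have "eval a z * Dx z + eval b z * Dy z =
      eval c z * (eval a z * eval (dx a) z + eval b z * eval (dy a) z) +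
      eval a z * (eval a z * eval (dx c) z + eval b z * eval (dy c) z) -
      eval b z * (eval a z * eval (dx b) z + eval b z * eval (dy b) z) -
      eval b z * (eval a z * eval (dx b) z + eval b z * eval (dy b) z)"
    by (simp add: Dx_def Dy_def algebra_simps)
  also have "\<dots> = eval c z * (eval a z * eval (dx a) z + eval b z * eval (dy a) z) +
      eval a z * (eval b z * eval (dx b) z + eval c z * eval (dy b) z) -
      eval b z * (eval b z * eval (dx a) z + eval c z * eval (dy a) z) -
      eval b z * (eval a z * eval (dx b) z + eval b z * eval (dy b) z)"
    by (simp only: commute_eval[of z])
  also have "\<dots> = D z * (eval (dx a) z + eval (dy b) z)"
    by (simp add: D_def algebra_simps)
  finally show ?thesis .
qed

lemma tangent\<^sub>2: "eval b z * Dx z + eval c z * Dy z = D z * (eval (dx b) z + eval (dy c) z)"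
proof -
  have "eval b z * Dx z + eval c z * Dy z =
      eval c z * (eval b z * eval (dx a) z + eval c z * eval (dy a) z) +
      eval a z * (eval b z * eval (dx c) z + eval c z * eval (dy c) z) -
      eval b z * (eval b z * eval (dx b) z + eval c z * eval (dy b) z) -
      eval b z * (eval b z * eval (dx b) z + eval c z * eval (dy b) z)"
    by (simp add: Dx_def Dy_def algebra_simps)
  also have "\<dots> = eval c z * (eval a z * eval (dx b) z + eval b z * eval (dy b) z) +
      eval a z * (eval b z * eval (dx c) z + eval c z * eval (dy c) z) -
      eval b z * (eval a z * eval (dx c) z + eval b z * eval (dy c) z) -
      eval b z * (eval b z * eval (dx b) z + eval c z * eval (dy b) z)"
    by (simp only: commute_eval[of z])
  also have "\<dots> = D z * (eval (dx b) z + eval (dy c) z)"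
    by (simp add: D_def algebra_simps)
  finally show ?thesis .
qed

lemma weak_pearson\<^sub>1: "(LINT z:\<Omega>|lebesgue. eval (\<psi>\<^sub>1 * p + a * dx p + b * dy p) z * \<rho> z) = 0"
  by (rule weak_pearson[OF _ tangent\<^sub>1]) (use \<alpha>\<beta>_solve D_nonzero in \<open>auto simp: \<eta>\<^sub>1_def\<close>)

lemma weak_pearson\<^sub>2: "(LINT z:\<Omega>|lebesgue. eval (\<psi>\<^sub>2 * p + b * dx p + c * dy p) z * \<rho> z) = 0"
  by (rule weak_pearson[OF _ tangent\<^sub>2]) (use \<alpha>\<beta>_solve D_nonzero in \<open>auto simp: \<eta>\<^sub>2_def\<close>)

end

section \<open>Leading coefficients and orthogonality\<close>

lemma const_0 [simp]: "const 0 = 0" and const_1 [simp]: "const 1 = 1"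
  and const_add: "const (c + d) = const c + const d" and const_mult: "const (c * d) = const c * const d"
  by (simp_all add: const_def one_pCons)

lemma const_sum: "const (sum f A) = (\<Sum>i\<in>A. const (f i))"
  by (induction A rule: infinite_finite_induct) (simp_all add: const_add)

lemma coeff_const_mult: "coeff (coeff (const c * p) j) i = c * coeff (coeff p j) i"
  by (simp add: const_def)

lemma coeff_monomial: "coeff (coeff (varx ^ k * vary ^ l) j) i = (if j = l \<and> i = k then 1 else 0)"
proof -
  have "varx ^ k = [:monom 1 k:]"
    by (induction k) (simp_all add: varx_def monom_Suc one_pCons mult.commute)
  moreover have "vary ^ l = monom 1 l"
  proof (induction l)
    case 0
    show ?case by (simp add: monom_0 one_pCons)
  qed (simp add: vary_def monom_Suc)
  ultimately have "varx ^ k * vary ^ l = monom (monom 1 k) l"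
    by (simp add: smult_monom)
  then show ?thesis by (simp add: coeff_monom)
qed

lemma poly_deg_less_0: "poly_deg_less 0 = {0}"
  by (auto simp: poly_deg_less_def poly_eq_iff)

lemma poly_deg_less_Suc: "poly_deg_less (Suc n) = poly_deg_le n"
  by (auto simp: poly_deg_less_def poly_deg_le_def less_Suc_eq_le)

text \<open>The bound adds up all the degrees in \<open>x\<close>, which is crude but avoids a maximum over a set.\<close>

lemma ex_poly_deg_less: "\<exists>n. p \<in> poly_deg_less n"
proof -
  define N where "N = degree p + (\<Sum>j\<le>degree p. degree (coeff p j))"
  have "i + j < Suc N" if nz: "coeff (coeff p j) i \<noteq> 0" for i j
  proof -
    have "coeff p j \<noteq> 0" using nz by auto
    then have j: "j \<le> degree p" by (rule le_degree)
    moreover have "i \<le> degree (coeff p j)" using nz by (rule le_degree)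
    moreover have "degree (coeff p j) \<le> (\<Sum>j\<le>degree p. degree (coeff p j))"
      using j by (intro member_le_sum) auto
    ultimately show ?thesis by (simp add: N_def)
  qed
  then have "p \<in> poly_deg_less (Suc N)" by (simp add: poly_deg_less_def)
  then show ?thesis ..
qed

text \<open>The coefficients of the homogeneous part of degree \<open>n\<close>, in the order of the monomials \<open>x\<^sup>n, x\<^sup>n\<^sup>-\<^sup>1 y, \<dots>, y\<^sup>n\<close>.\<close>

definition lead :: "nat \<Rightarrow> bipoly \<Rightarrow> nat \<Rightarrow> real" where
  "lead n p i = coeff (coeff p i) (n - i)"

lemma poly_deg_le_remainder:
  assumes "p \<in> poly_deg_le n"
  shows "p - (\<Sum>i\<le>n. const (lead n p i) * (varx ^ (n - i) * vary ^ i)) \<in> poly_deg_less n"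
proof -
  have *: "coeff (coeff (\<Sum>i\<le>n. const (lead n p i) * (varx ^ (n - i) * vary ^ i)) j) k =
      (if j + k = n then coeff (coeff p j) k else 0)" for j k
  proof -
    have "coeff (coeff (\<Sum>i\<le>n. const (lead n p i) * (varx ^ (n - i) * vary ^ i)) j) k =
        (\<Sum>i\<le>n. if i = j then (if k = n - j then lead n p j else 0) else 0)"
      unfolding coeff_sum by (rule sum.cong) (auto simp: coeff_const_mult coeff_monomial)
    also have "\<dots> = (if j \<le> n then (if k = n - j then lead n p j else 0) else 0)" by simp
    also have "\<dots> = (if j + k = n then coeff (coeff p j) k else 0)" by (auto simp: lead_def)
    finally show ?thesis .
  qed
  show ?thesis
    using assms by (auto simp: poly_deg_less_def poly_deg_le_def * split: if_splits) (metis add.commute le_neq_implies_less)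
qed

definition bipoly_subspace :: "bipoly set \<Rightarrow> bool" where
  "bipoly_subspace S \<longleftrightarrow> 0 \<in> S \<and> (\<forall>p\<in>S. \<forall>q\<in>S. p + q \<in> S) \<and> (\<forall>c. \<forall>p\<in>S. const c * p \<in> S)"

lemma
  assumes "bipoly_subspace S"
  shows subspace_0: "0 \<in> S" and subspace_add: "p \<in> S \<Longrightarrow> q \<in> S \<Longrightarrow> p + q \<in> S"
    and subspace_scale: "p \<in> S \<Longrightarrow> const c * p \<in> S"
    and subspace_diff: "p \<in> S \<Longrightarrow> q \<in> S \<Longrightarrow> p - q \<in> S"
    and subspace_sum: "(\<And>i. i \<in> A \<Longrightarrow> f i \<in> S) \<Longrightarrow> sum f A \<in> S"
proof -
  show 0: "0 \<in> S" and a: "p \<in> S \<Longrightarrow> q \<in> S \<Longrightarrow> p + q \<in> S" and s: "p \<in> S \<Longrightarrow> const c * p \<in> S" for p q c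
    using assms by (auto simp: bipoly_subspace_def)
  have "const (- 1) = - 1" by (simp add: const_def one_pCons)
  then show "p - q \<in> S" if "p \<in> S" "q \<in> S"
    using a[OF that(1) s[OF that(2), of "- 1"]] by simp
  show "(\<And>i. i \<in> A \<Longrightarrow> f i \<in> S) \<Longrightarrow> sum f A \<in> S"
    by (induction A rule: infinite_finite_induct) (auto intro: 0 a)
qed

text \<open>Induction on the degree, splitting off the homogeneous part of highest degree. Restricting to degree less
than \<open>n\<close> lets it serve both for spanning and for orthogonality to lower degrees.\<close>

lemma monomials_span:
  assumes S: "bipoly_subspace S" and mono: "\<And>m i. m < n \<Longrightarrow> i \<le> m \<Longrightarrow> varx ^ (m - i) * vary ^ i \<in> S"
  shows "poly_deg_less n \<subseteq> S"
  using mono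
proof (induction n)
  case 0
  then show ?case using subspace_0[OF S] by (simp add: poly_deg_less_0)
next
  case (Suc n)
  show ?case
  proof
    fix p assume "p \<in> poly_deg_less (Suc n)"
    then have p: "p \<in> poly_deg_le n" by (simp add: poly_deg_less_Suc)
    let ?q = "\<Sum>i\<le>n. const (lead n p i) * (varx ^ (n - i) * vary ^ i)"
    have "p - ?q \<in> S" using Suc.IH Suc.prems poly_deg_le_remainder[OF p] by auto
    moreover have "?q \<in> S" using Suc.prems by (intro subspace_sum[OF S] subspace_scale[OF S]) auto
    ultimately have "(p - ?q) + ?q \<in> S" by (rule subspace_add[OF S])
    then show "p \<in> S" by simp
  qed
qed

definition lead_mat :: "(nat \<Rightarrow> bipoly mat) \<Rightarrow> nat \<Rightarrow> real mat" where
  "lead_mat P n = Matrix.mat (n + 1) (n + 1) (\<lambda>(k, i). lead n (P n $$ (k, 0)) i)"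

lemma lead_mat_carrier [simp]: "lead_mat P n \<in> carrier_mat (n + 1) (n + 1)"
  by (simp add: lead_mat_def)

text \<open>A nonzero vector in the kernel of the transposed matrix would give a nontrivial combination of the entries of
\<open>P\<^sub>n\<close> whose homogeneous part of degree \<open>n\<close> vanishes, contrary to independence modulo lower degree.\<close>

lemma lead_mat_inverse:
  assumes P: "polynomial_system P"
  obtains B where "B \<in> carrier_mat (n + 1) (n + 1)" "B * lead_mat P n = 1\<^sub>m (n + 1)" "lead_mat P n * B = 1\<^sub>m (n + 1)"
proof -
  let ?G = "lead_mat P n"
  have Gt: "transpose_mat ?G \<in> carrier_mat (n + 1) (n + 1)"
    by (simp add: lead_mat_def)
  have "Determinant.det (transpose_mat ?G) \<noteq> 0"
  proof
    assume "Determinant.det (transpose_mat ?G) = 0"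
    then obtain c where c: "c \<in> carrier_vec (n + 1)" "c \<noteq> 0\<^sub>v (n + 1)" "transpose_mat ?G *\<^sub>v c = 0\<^sub>v (n + 1)"
      using det_0_iff_vec_prod_zero[OF Gt] by blast
    let ?q = "\<Sum>k\<le>n. const (vec_index c k) * P n $$ (k, 0)"
    have zero: "(\<Sum>k\<le>n. lead n (P n $$ (k, 0)) i * vec_index c k) = 0" if "i \<le> n" for i
    proof -
      have "vec_index (transpose_mat ?G *\<^sub>v c) i = (\<Sum>k\<in>{0..<n + 1}. lead n (P n $$ (k, 0)) i * vec_index c k)"
        using that c(1) by (auto simp: lead_mat_def scalar_prod_def intro!: sum.cong)
      also have "{0..<n + 1} = {..n}" by auto
      finally show ?thesis using that unfolding c(3) by simp
    qed
    have "?q \<in> poly_deg_less n"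
      unfolding poly_deg_less_def
    proof (intro CollectI allI impI)
      fix i j assume nz: "coeff (coeff ?q j) i \<noteq> 0"
      have eq: "coeff (coeff ?q j) i = (\<Sum>k\<le>n. vec_index c k * coeff (coeff (P n $$ (k, 0)) j) i)"
        by (simp add: coeff_sum coeff_const_mult)
      then obtain k where k: "k \<le> n" "coeff (coeff (P n $$ (k, 0)) j) i \<noteq> 0"
        using nz by (metis (no_types, lifting) atMost_iff mult_zero_right sum.neutral)
      then have "i + j \<le> n" using P by (auto simp: polynomial_system_def poly_deg_le_def)
      moreover have "i + j \<noteq> n"
      proof
        assume "i + j = n"
        then have "coeff (coeff ?q j) i = 0"
          using zero[of j] by (auto simp: eq lead_def mult.commute)
        then show False using nz by simp
      qed
      ultimately show "i + j < n" by simp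
    qed
    then have "\<forall>k\<le>n. vec_index c k = 0" using P by (simp add: polynomial_system_def)
    then have "c = 0\<^sub>v (n + 1)" using c(1) by (intro eq_vecI) auto
    then show False using c(2) by simp
  qed
  then have "Determinant.det ?G \<noteq> 0" using det_transpose[OF lead_mat_carrier] by simp
  then have "?G \<in> Units (ring_mat TYPE(real) (n + 1) ())"
    by (rule det_non_zero_imp_unit[OF lead_mat_carrier])
  then show thesis using that by (auto simp: Units_def ring_mat_def)
qed

lemma system_entry_remainder:
  assumes "polynomial_system P" "k \<le> n"
  shows "P n $$ (k, 0) - (\<Sum>i\<le>n. const (lead_mat P n $$ (k, i)) * (varx ^ (n - i) * vary ^ i)) \<in> poly_deg_less n"
proof -
  have "(\<Sum>i\<le>n. const (lead_mat P n $$ (k, i)) * (varx ^ (n - i) * vary ^ i)) =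
      (\<Sum>i\<le>n. const (lead n (P n $$ (k, 0)) i) * (varx ^ (n - i) * vary ^ i))"
    using assms(2) by (intro sum.cong) (auto simp: lead_mat_def)
  then show ?thesis
    using poly_deg_le_remainder[of "P n $$ (k, 0)" n] assms by (simp add: polynomial_system_def)
qed

lemma index_mult_mat_sum:
  assumes "A \<in> carrier_mat (n + 1) (n + 1)" "B \<in> carrier_mat (n + 1) (n + 1)" "i \<le> n" "k \<le> n"
  shows "(A * B) $$ (i, k) = (\<Sum>l\<le>n. A $$ (i, l) * B $$ (l, k))"
proof -
  have "(A * B) $$ (i, k) = (\<Sum>l\<in>{0..<n + 1}. A $$ (i, l) * B $$ (l, k))"
    using assms by (auto simp: scalar_prod_def intro!: sum.cong)
  also have "{0..<n + 1} = {..n}" by auto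
  finally show ?thesis .
qed

text \<open>With the inverse of the leading coefficient matrix, a monomial of degree \<open>n\<close> is a combination of entries of \<open>P\<^sub>n\<close>
modulo polynomials of lower degree, which belong to the subspace by induction.\<close>

lemma polynomial_system_spans:
  assumes P: "polynomial_system P" and S: "bipoly_subspace S"
    and mem: "\<And>n k. k \<le> n \<Longrightarrow> P n $$ (k, 0) \<in> S"
  shows "p \<in> S"
proof -
  have "varx ^ (n - i) * vary ^ i \<in> S" if "i \<le> n" for n i
    using that
  proof (induction n arbitrary: i rule: less_induct)
    case (less n)
    have low: "poly_deg_less n \<subseteq> S" by (rule monomials_span[OF S]) (use less.IH in auto)
    obtain B where B: "B \<in> carrier_mat (n + 1) (n + 1)" "B * lead_mat P n = 1\<^sub>m (n + 1)"
      using lead_mat_inverse[OF P] by metis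
    let ?X = "\<lambda>l. varx ^ (n - l) * vary ^ l"
    \<comment> \<open>The homogeneous part of degree \<open>n\<close> of the entry \<open>k\<close>.\<close>
    define R where "R k = (\<Sum>l\<le>n. const (lead_mat P n $$ (k, l)) * ?X l)" for k
    have R: "R k \<in> S" if "k \<le> n" for k
    proof -
      have "P n $$ (k, 0) - R k \<in> S"
        using system_entry_remainder[OF P that] low unfolding R_def by blast
      from subspace_diff[OF S mem[OF that] this] show ?thesis by simp
    qed
    have BG: "(\<Sum>k\<le>n. B $$ (i, k) * lead_mat P n $$ (k, l)) = (if i = l then 1 else 0)" if "l \<le> n" for l
    proof -
      have "(B * lead_mat P n) $$ (i, l) = (\<Sum>k\<le>n. B $$ (i, k) * lead_mat P n $$ (k, l))"
        by (rule index_mult_mat_sum[OF B(1) lead_mat_carrier less.prems that])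
      then show ?thesis using that less.prems by (simp add: B(2))
    qed
    have "(\<Sum>k\<le>n. const (B $$ (i, k)) * R k) =
        (\<Sum>k\<le>n. \<Sum>l\<le>n. const (B $$ (i, k) * lead_mat P n $$ (k, l)) * ?X l)"
      by (simp add: R_def sum_distrib_left const_mult mult.assoc)
    also have "\<dots> = (\<Sum>l\<le>n. \<Sum>k\<le>n. const (B $$ (i, k) * lead_mat P n $$ (k, l)) * ?X l)"
      by (rule sum.swap)
    also have "\<dots> = (\<Sum>l\<le>n. const (\<Sum>k\<le>n. B $$ (i, k) * lead_mat P n $$ (k, l)) * ?X l)"
      by (simp only: const_sum sum_distrib_right)
    also have "\<dots> = (\<Sum>l\<le>n. if l = i then ?X l else 0)"
      by (rule sum.cong) (auto simp: BG)
    also have "\<dots> = ?X i" using less.prems by simp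
    finally have "?X i = (\<Sum>k\<le>n. const (B $$ (i, k)) * R k)" by simp
    also have "\<dots> \<in> S" using R by (intro subspace_sum[OF S] subspace_scale[OF S]) auto
    finally show ?case .
  qed
  then have "poly_deg_less n \<subseteq> S" for n by (intro monomials_span[OF S]) auto
  then show ?thesis using ex_poly_deg_less[of p] by auto
qed

lemma mult_transpose_column:
  assumes "A \<in> carrier_mat r 1" "B \<in> carrier_mat s 1" "i < r" "k < s"
  shows "(A * transpose_mat B) $$ (i, k) = A $$ (i, 0) * B $$ (k, 0)"
  using assms by (simp add: scalar_prod_def)

text \<open>A factor may be replaced by its homogeneous part of highest degree, as lower degrees are annihilated. On the
diagonal this gives \<open>\<langle>v, P\<^sub>n P\<^sub>n\<^sup>t\<rangle> = G \<langle>v, X\<^sub>n P\<^sub>n\<^sup>t\<rangle>\<close> with \<open>G\<close> the leading coefficient matrix.\<close>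

lemma orthogonal_wrt_functional_of_monomials:
  fixes v :: functional
  assumes P: "polynomial_system P"
    and add: "\<And>p q. v (p + q) = v p + v q" and scale: "\<And>c p. v (const c * p) = c * v p"
    and orth: "\<And>m n i k. m < n \<Longrightarrow> i \<le> m \<Longrightarrow> k \<le> n \<Longrightarrow> v (varx ^ (m - i) * vary ^ i * P n $$ (k, 0)) = 0"
    and nondeg: "\<And>n. invertible_mat (map_mat v (monomials n * transpose_mat (P n)))"
  shows "orthogonal_wrt_functional v P"
proof -
  have v0: "v 0 = 0" using scale[of 0 0] by simp
  have vsum: "v (sum f A) = (\<Sum>i\<in>A. v (f i))" for f :: "nat \<Rightarrow> bipoly" and A
    by (induction A rule: infinite_finite_induct) (simp_all add: add v0)
  have Pc: "P n \<in> carrier_mat (n + 1) 1" for n using P by (simp add: polynomial_system_def)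
  have low: "v (p * P n $$ (k, 0)) = 0" if p: "p \<in> poly_deg_less n" and k: "k \<le> n" for p n k
  proof -
    let ?S = "{p. v (p * P n $$ (k, 0)) = 0}"
    have "bipoly_subspace ?S"
      by (auto simp: bipoly_subspace_def v0 distrib_right add mult.assoc scale)
    then have "poly_deg_less n \<subseteq> ?S" by (rule monomials_span) (use orth k in auto)
    then show ?thesis using p by auto
  qed
  have lt: "v (P m $$ (i, 0) * P n $$ (k, 0)) = 0" if "m < n" "i \<le> m" "k \<le> n" for m n i k
  proof (rule low[OF _ that(3)])
    have "P m $$ (i, 0) \<in> poly_deg_le m" using P that by (simp add: polynomial_system_def)
    then show "P m $$ (i, 0) \<in> poly_deg_less n" using that(1) by (fastforce simp: poly_deg_le_def poly_deg_less_def)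
  qed
  have off: "map_mat v (P m * transpose_mat (P n)) = 0\<^sub>m (m + 1) (n + 1)" if "m \<noteq> n" for m n
  proof (rule eq_matI)
    fix i k assume ik: "i < dim_row (0\<^sub>m (m + 1) (n + 1))" "k < dim_col (0\<^sub>m (m + 1) (n + 1))"
    have "v (P m $$ (i, 0) * P n $$ (k, 0)) = 0"
      using that lt[of m n i k] lt[of n m k i] ik by (cases m n rule: linorder_cases) (auto simp: mult.commute)
    then show "map_mat v (P m * transpose_mat (P n)) $$ (i, k) = 0\<^sub>m (m + 1) (n + 1) $$ (i, k)"
      using ik Pc[of m] Pc[of n] mult_transpose_column[OF Pc[of m] Pc[of n], of i k] by simp
  qed (use Pc[of m] Pc[of n] in simp_all)
  have diag: "invertible_mat (map_mat v (P n * transpose_mat (P n)))" for n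
  proof -
    let ?G = "lead_mat P n" and ?N = "map_mat v (monomials n * transpose_mat (P n))"
    have mono: "monomials n \<in> carrier_mat (n + 1) 1" by (simp add: monomials_def)
    have Nc: "?N \<in> carrier_mat (n + 1) (n + 1)" using mono Pc[of n] by simp
    have N: "?N $$ (l, k) = v (varx ^ (n - l) * vary ^ l * P n $$ (k, 0))" if "l \<le> n" "k \<le> n" for l k
      using that Pc[of n] mono mult_transpose_column[OF mono Pc[of n], of l k] by (simp add: monomials_def)
    have eq: "map_mat v (P n * transpose_mat (P n)) = ?G * ?N"
    proof (rule eq_matI)
      fix i k assume "i < dim_row (?G * ?N)" "k < dim_col (?G * ?N)"
      then have ik: "i \<le> n" "k \<le> n" using Nc lead_mat_carrier[of P n] by auto
      let ?q = "\<Sum>l\<le>n. const (?G $$ (i, l)) * (varx ^ (n - l) * vary ^ l)"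
      have "(?G * ?N) $$ (i, k) = (\<Sum>l\<le>n. ?G $$ (i, l) * ?N $$ (l, k))"
        by (rule index_mult_mat_sum[OF lead_mat_carrier Nc ik])
      also have "\<dots> = (\<Sum>l\<le>n. ?G $$ (i, l) * v (varx ^ (n - l) * vary ^ l * P n $$ (k, 0)))"
        by (rule sum.cong) (use N ik in auto)
      also have "\<dots> = v (?q * P n $$ (k, 0))"
        by (simp only: sum_distrib_right vsum mult.assoc scale)
      also have "\<dots> = v ((P n $$ (i, 0) - ?q) * P n $$ (k, 0)) + v (?q * P n $$ (k, 0))"
        using low[OF system_entry_remainder[OF P ik(1)] ik(2)] by simp
      also have "\<dots> = v (P n $$ (i, 0) * P n $$ (k, 0))"
        by (simp flip: add distrib_right)
      finally show "map_mat v (P n * transpose_mat (P n)) $$ (i, k) = (?G * ?N) $$ (i, k)"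
        using ik Pc[of n] mult_transpose_column[OF Pc[of n] Pc[of n], of i k] by simp
    qed (use Nc lead_mat_carrier[of P n] Pc[of n] in simp_all)
    obtain B where B: "B \<in> carrier_mat (n + 1) (n + 1)" "B * ?G = 1\<^sub>m (n + 1)" "?G * B = 1\<^sub>m (n + 1)"
      using lead_mat_inverse[OF P] by metis
    obtain M where M: "?N * M = 1\<^sub>m (n + 1)" "M * ?N = 1\<^sub>m (dim_row M)"
      using nondeg[of n] Nc by (auto simp: invertible_mat_def inverts_mat_def)
    have Mc: "M \<in> carrier_mat (n + 1) (n + 1)"
      using arg_cong[OF M(1), of dim_col] arg_cong[OF M(2), of dim_col] Nc by (intro carrier_matI) auto
    have M': "M * ?N = 1\<^sub>m (n + 1)" using M(2) Mc by simp
    have "(?G * ?N) * (M * B) = ?G * (?N * M) * B" "(M * B) * (?G * ?N) = M * (B * ?G) * ?N"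
      using Nc Mc B(1) lead_mat_carrier[of P n] by (simp_all add: assoc_mult_mat[of _ "n+1" "n+1" _ "n+1" _ "n+1"] mult_carrier_mat[of _ "n+1" "n+1" _ "n+1"] del: One_nat_def)
    then have "(?G * ?N) * (M * B) = 1\<^sub>m (n + 1)" "(M * B) * (?G * ?N) = 1\<^sub>m (n + 1)"
      using M(1) M' B Mc Nc lead_mat_carrier[of P n] by simp_all
    moreover have "dim_row (?G * ?N) = n + 1" "dim_col (?G * ?N) = n + 1" "dim_row (M * B) = n + 1"
      using Nc Mc lead_mat_carrier[of P n] by auto
    ultimately show ?thesis
      unfolding eq invertible_mat_def inverts_mat_def square_mat.simps by metis
  qed
  show ?thesis unfolding orthogonal_wrt_functional_def using off diag by blast
qed

section \<open>Classical weights and their moment functionals\<close>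

text \<open>Positivity of the form is the notion that survives integration against the weight, in contrast to the sign of
the determinant.\<close>

lemma quadratic_form_2:
  fixes A :: "real mat"
  assumes "A \<in> carrier_mat 2 2" "positive_definite A" "A $$ (1, 0) = A $$ (0, 1)" "s \<noteq> 0 \<or> t \<noteq> 0"
  shows "A $$ (0, 0) * (s * s) + 2 * A $$ (0, 1) * (s * t) + A $$ (1, 1) * (t * t) > 0"
proof -
  define \<xi> where "\<xi> = Matrix.vec 2 (\<lambda>i. if i = 0 then s else t)"
  have \<xi>: "\<xi> \<in> carrier_vec (dim_row A)" using assms(1) by (simp add: \<xi>_def)
  have "\<xi> \<noteq> 0\<^sub>v (dim_row A)"
  proof
    assume "\<xi> = 0\<^sub>v (dim_row A)"
    then have "vec_index \<xi> 0 = 0" "vec_index \<xi> 1 = 0" using assms(1) by simp_all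
    then show False using assms(4) by (simp add: \<xi>_def)
  qed
  then have "scalar_prod \<xi> (A *\<^sub>v \<xi>) > 0" using assms(2) \<xi> by (auto simp: positive_definite_def)
  also have "scalar_prod \<xi> (A *\<^sub>v \<xi>) = s * (A $$ (0, 0) * s + A $$ (0, 1) * t) + t * (A $$ (1, 0) * s + A $$ (1, 1) * t)"
    using assms(1) by (simp add: \<xi>_def scalar_prod_def numeral_2_eq_2)
  also have "\<dots> = A $$ (0, 0) * (s * s) + 2 * A $$ (0, 1) * (s * t) + A $$ (1, 1) * (t * t)"
    using assms(3) by (simp add: algebra_simps)
  finally show ?thesis .
qed

lemma det_nonzero_of_quadratic_form:
  fixes M :: "real mat"
  assumes M: "M \<in> carrier_mat 2 2" and sym: "M $$ (1, 0) = M $$ (0, 1)"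
    and pos: "\<And>s t. s \<noteq> 0 \<or> t \<noteq> 0 \<Longrightarrow>
      M $$ (0, 0) * (s * s) + 2 * M $$ (0, 1) * (s * t) + M $$ (1, 1) * (t * t) > 0"
  shows "Determinant.det M \<noteq> 0"
proof
  assume "Determinant.det M = 0"
  then obtain x where x: "x \<in> carrier_vec 2" "x \<noteq> 0\<^sub>v 2" "M *\<^sub>v x = 0\<^sub>v 2"
    using det_0_iff_vec_prod_zero[OF M] by auto
  define s where "s = vec_index x 0" define t where "t = vec_index x 1"
  have nz: "s \<noteq> 0 \<or> t \<noteq> 0"
  proof (rule ccontr)
    assume "\<not> ?thesis"
    then have "vec_index x i = 0" if "i < 2" for i using that by (auto simp: s_def t_def less_2_cases_iff)
    then show False using x(1,2) by (metis carrier_vecD eq_vecI index_zero_vec)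
  qed
  have "vec_index (M *\<^sub>v x) 0 = M $$ (0, 0) * s + M $$ (0, 1) * t" "vec_index (M *\<^sub>v x) 1 = M $$ (1, 0) * s + M $$ (1, 1) * t"
    using M x(1) by (simp_all add: s_def t_def scalar_prod_def numeral_2_eq_2)
  then have "M $$ (0, 0) * s + M $$ (0, 1) * t = 0" "M $$ (0, 1) * s + M $$ (1, 1) * t = 0"
    using sym by (simp_all add: x(3))
  then have "s * (M $$ (0, 0) * s + M $$ (0, 1) * t) + t * (M $$ (0, 1) * s + M $$ (1, 1) * t) = 0"
    by simp
  then show False using pos[OF nz] by (simp add: algebra_simps)
qed

lemma integral_pos_on_open:
  fixes f :: "real \<times> real \<Rightarrow> real"
  assumes "open \<Omega>" "\<Omega> \<noteq> {}" and f: "set_integrable lebesgue \<Omega> f" and pos: "\<And>z. z \<in> \<Omega> \<Longrightarrow> f z > 0"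
  shows "(LINT z:\<Omega>|lebesgue. f z) > 0"
proof -
  let ?g = "\<lambda>z. indicator \<Omega> z *\<^sub>R f z"
  have g: "integrable lebesgue ?g" using f by (simp add: set_integrable_def)
  have nonneg: "AE z in lebesgue. 0 \<le> ?g z" using pos by (auto intro!: AE_I2 simp: indicator_def less_imp_le)
  have "integral\<^sup>L lebesgue ?g \<noteq> 0"
  proof
    assume "integral\<^sup>L lebesgue ?g = 0"
    then have "AE z in lebesgue. ?g z = 0"
      using integral_nonneg_eq_0_iff_AE[OF g nonneg] by simp
    then have "AE z in lebesgue. z \<notin> \<Omega>"
      by eventually_elim (use pos in \<open>force simp: indicator_def split: if_splits\<close>)
    then have "negligible \<Omega>" by (simp add: negligible_iff_null_sets AE_iff_null_sets \<open>open \<Omega>\<close>)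
    then show False using open_not_negligible assms by blast
  qed
  moreover have "integral\<^sup>L lebesgue ?g \<ge> 0" by (rule integral_nonneg_AE[OF nonneg])
  ultimately show ?thesis unfolding set_lebesgue_integral_def by linarith
qed

lemma pearson_weight_of_classical_weight:
  assumes \<Omega>: "open \<Omega>" "simply_connected \<Omega>" "has_outer_normals \<Omega>"
    and cl: "classical_weight \<Omega> \<rho> \<Phi> \<psi>\<^sub>1 \<psi>\<^sub>2"
    and moments: "\<And>p. weighted_integrable \<Omega> \<rho> p" and nontrivial: "\<exists>z\<in>\<Omega>. \<rho> z \<noteq> 0"
  shows "pearson_weight \<Omega> \<rho> (\<Phi> $$ (0, 0)) (\<Phi> $$ (0, 1)) (\<Phi> $$ (1, 1)) \<psi>\<^sub>1 \<psi>\<^sub>2"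
proof -
  let ?a = "\<Phi> $$ (0, 0)" and ?b = "\<Phi> $$ (0, 1)" and ?c = "\<Phi> $$ (1, 1)"
  have \<Phi>: "\<Phi> \<in> carrier_mat 2 2" and "transpose_mat \<Phi> = \<Phi>"
    and wt: "weight_function \<Omega> \<rho>" and pd: "\<And>z. z \<in> \<Omega> \<Longrightarrow> positive_definite (eval_mat \<Phi> z)"
    and bc: "boundary_condition \<Omega> \<rho> \<Phi>"
    and comm: "\<And>j. j < 2 \<Longrightarrow> \<Phi> $$ (0, j) \<cdot>\<^sub>m map_mat dx \<Phi> + \<Phi> $$ (1, j) \<cdot>\<^sub>m map_mat dy \<Phi>
        = \<Phi> * grad (row2 (\<Phi> $$ (0, j)) (\<Phi> $$ (1, j)))"
    and pearson: "weight_pearson \<Omega> \<rho> \<Phi> \<psi>\<^sub>1 \<psi>\<^sub>2"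
    using cl unfolding classical_weight_def by blast+
  have sym: "\<Phi> $$ (1, 0) = ?b"
    using \<Phi> \<open>transpose_mat \<Phi> = \<Phi>\<close> by (metis carrier_matD index_transpose_mat(1) one_less_numeral_iff pos2 semiring_norm(76))
  have row2_index: "row2 u v $$ (0, 0) = u" "row2 u v $$ (0, 1) = v" "row2 u v \<in> carrier_mat 1 2" for u v :: bipoly
    by (simp_all add: row2_def mat_of_rows_list_def)
  have quad: "eval ?a z * (s * s) + 2 * eval ?b z * (s * t) + eval ?c z * (t * t) > 0"
    if "z \<in> \<Omega>" "s \<noteq> 0 \<or> t \<noteq> 0" for z s t
    using quadratic_form_2[OF _ pd[OF that(1)] _ that(2)] \<Phi> sym by (simp add: eval_mat_def)
  have a_pos: "eval ?a z > 0" and c_pos: "eval ?c z > 0" if "z \<in> \<Omega>" for z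
    using quad[OF that, of 1 0] quad[OF that, of 0 1] by simp_all
  have comm': "\<Phi> $$ (0, j) * dx (\<Phi> $$ (i, k)) + \<Phi> $$ (1, j) * dy (\<Phi> $$ (i, k)) =
      \<Phi> $$ (i, 0) * dx (\<Phi> $$ (k, j)) + \<Phi> $$ (i, 1) * dy (\<Phi> $$ (k, j))" if "i < 2" "j < 2" "k < 2" for i j k
  proof -
    have "grad (row2 (\<Phi> $$ (0, j)) (\<Phi> $$ (1, j))) $$ (0, k) = dx (\<Phi> $$ (k, j))"
      "grad (row2 (\<Phi> $$ (0, j)) (\<Phi> $$ (1, j))) $$ (1, k) = dy (\<Phi> $$ (k, j))"
      "grad (row2 (\<Phi> $$ (0, j)) (\<Phi> $$ (1, j))) \<in> carrier_mat 2 2"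
      using that row2_index[of "\<Phi> $$ (0, j)" "\<Phi> $$ (1, j)"]
      by (auto simp: grad_def append_rows_def less_2_cases_iff)
    then have "(\<Phi> * grad (row2 (\<Phi> $$ (0, j)) (\<Phi> $$ (1, j)))) $$ (i, k) =
        \<Phi> $$ (i, 0) * dx (\<Phi> $$ (k, j)) + \<Phi> $$ (i, 1) * dy (\<Phi> $$ (k, j))"
      using \<Phi> that by (simp add: scalar_prod_def numeral_2_eq_2)
    then show ?thesis unfolding comm[OF that(2), symmetric] using \<Phi> that by simp
  qed
  have flux0: "((\<lambda>w. flux \<rho> \<Phi> (Matrix.mat 1 1 (\<lambda>_. p)) w \<nu> $$ (0, 0)) \<longlongrightarrow> 0) (at z within \<Omega>)"
    if normal: "outer_normal \<Omega> z \<nu>" for z \<nu> p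
  proof -
    obtain l :: "nat \<Rightarrow> real" where "\<forall>\<^sub>F j in sequentially. boundary_value (\<Omega> \<inter> ball 0 (real j))
        (\<lambda>w \<nu>. flux \<rho> \<Phi> (Matrix.mat 1 1 (\<lambda>_. p)) w \<nu> $$ (0, 0)) z (l j)" "l \<longlonglongrightarrow> 0"
      using bc unfolding boundary_condition_def
      by (elim allE[of _ 1] impE ballE[of _ _ "Matrix.mat 1 1 (\<lambda>_. p)"] allE[of _ 0] allE[of _ z] exE) auto
    then show ?thesis by (rule boundary_limit_eq_0[OF \<Omega>(1) normal])
  qed
  show ?thesis
  proof
    show "open \<Omega>" "has_outer_normals \<Omega>" "\<exists>z\<in>\<Omega>. \<rho> z \<noteq> 0" by fact+
    show "connected \<Omega>" using \<Omega>(2) by (simp add: simply_connected_imp_path_connected path_connected_imp_connected)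
    show "eval ?a z > 0" "eval ?c z > 0" if "z \<in> \<Omega>" for z using a_pos c_pos that by auto
    show "eval ?a z * eval ?c z - eval ?b z * eval ?b z > 0" if z: "z \<in> \<Omega>" for z
    proof -
      have "0 < eval ?a z * (eval ?b z * eval ?b z) + 2 * eval ?b z * (- eval ?b z * eval ?a z) + eval ?c z * (eval ?a z * eval ?a z)"
        using quad[OF z, of "- eval ?b z" "eval ?a z"] a_pos[OF z] by simp
      also have "\<dots> = eval ?a z * (eval ?a z * eval ?c z - eval ?b z * eval ?b z)" by (simp add: algebra_simps)
      finally show ?thesis using a_pos[OF z] by (simp add: zero_less_mult_iff)
    qed
    show "\<rho> z \<ge> 0" if "z \<in> \<Omega>" for z using wt that by (simp add: weight_function_def)
    have pear: "\<exists>d e. has_dx (\<lambda>w. \<rho> w * eval (\<Phi> $$ (0, j)) w) d z \<and> has_dy (\<lambda>w. \<rho> w * eval (\<Phi> $$ (1, j)) w) e z \<and>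
        d + e = \<rho> z * eval (row2 \<psi>\<^sub>1 \<psi>\<^sub>2 $$ (0, j)) z" if "z \<in> \<Omega>" "j < 2" for z j
      using pearson that unfolding weight_pearson_def has_dx_def has_dy_def by (cases z) fastforce
    show "\<exists>d e. has_dx (\<lambda>w. \<rho> w * eval ?a w) d z \<and> has_dy (\<lambda>w. \<rho> w * eval ?b w) e z \<and> d + e = \<rho> z * eval \<psi>\<^sub>1 z"
      if "z \<in> \<Omega>" for z using pear[OF that, of 0] sym by (simp add: row2_index)
    show "\<exists>d e. has_dx (\<lambda>w. \<rho> w * eval ?b w) d z \<and> has_dy (\<lambda>w. \<rho> w * eval ?c w) e z \<and> d + e = \<rho> z * eval \<psi>\<^sub>2 z"
      if "z \<in> \<Omega>" for z using pear[OF that, of 1] row2_index(2)[of \<psi>\<^sub>1 \<psi>\<^sub>2] by simp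
    show "?a * dx ?b + ?b * dy ?b = ?b * dx ?a + ?c * dy ?a"
      using comm'[of 1 0 0] sym by simp
    show "?a * dx ?c + ?b * dy ?c = ?b * dx ?b + ?c * dy ?b"
      using comm'[of 1 0 1] sym by simp
    show "set_integrable lebesgue \<Omega> (\<lambda>z. eval p z * \<rho> z)" for p
      using moments[of p] by (simp add: weighted_integrable_def)
    show "((\<lambda>w. \<rho> w * (eval ?a w * fst \<nu> + eval ?b w * snd \<nu>)) \<longlongrightarrow> 0) (at z within \<Omega>)"
      if "outer_normal \<Omega> z \<nu>" for z \<nu>
      using flux0[OF that, of varx] unfolding flux_1x1[OF \<Phi>] sym by simp
    show "((\<lambda>w. \<rho> w * (eval ?b w * fst \<nu> + eval ?c w * snd \<nu>)) \<longlongrightarrow> 0) (at z within \<Omega>)"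
      if "outer_normal \<Omega> z \<nu>" for z \<nu>
      using flux0[OF that, of vary] unfolding flux_1x1[OF \<Phi>] by simp
  qed
qed

theorem proposition17:
  fixes \<Omega> :: "(real \<times> real) set" and \<rho> :: "real \<times> real \<Rightarrow> real"
    and \<Phi> :: "bipoly mat" and \<psi>\<^sub>1 \<psi>\<^sub>2 :: bipoly
    and P :: "nat \<Rightarrow> bipoly mat" and v :: functional
  assumes "open \<Omega>" and "simply_connected \<Omega>" and "has_outer_normals \<Omega>"
    and "classical_weight \<Omega> \<rho> \<Phi> \<psi>\<^sub>1 \<psi>\<^sub>2"
    and "orthogonal_wrt_weight \<Omega> \<rho> P"
    and "\<And>p. v p = weighted_integral \<Omega> \<rho> p"
  shows "(\<forall>p. weighted_integrable \<Omega> \<rho> p) \<and> moment_functional v \<and>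
    orthogonal_wrt_functional v P \<and>
    div_functional \<Phi> v = mult_row_functional (row2 \<psi>\<^sub>1 \<psi>\<^sub>2) v \<and>
    Determinant.det (map_mat v \<Phi>) \<noteq> 0"
proof -
  note v = assms(6)
  have P: "polynomial_system P"
    and Pint: "\<And>n m i k. m \<le> n \<Longrightarrow> i \<le> m \<Longrightarrow> k \<le> n \<Longrightarrow>
        weighted_integrable \<Omega> \<rho> ((monomials m * transpose_mat (P n)) $$ (i, k))"
    and orth: "\<And>n m. m < n \<Longrightarrow> map_mat (weighted_integral \<Omega> \<rho>) (monomials m * transpose_mat (P n)) = 0\<^sub>m (m + 1) (n + 1)"
    and nondeg: "\<And>n. invertible_mat (map_mat (weighted_integral \<Omega> \<rho>) (monomials n * transpose_mat (P n)))"
    using assms(5) unfolding orthogonal_wrt_weight_def by auto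
  have v_def: "v = weighted_integral \<Omega> \<rho>" using v by blast
  have Pc: "P n \<in> carrier_mat (n + 1) 1" for n using P by (simp add: polynomial_system_def)
  have mono: "monomials n \<in> carrier_mat (n + 1) 1" for n by (simp add: monomials_def)
  have entry: "(monomials m * transpose_mat (P n)) $$ (i, k) = varx ^ (m - i) * vary ^ i * P n $$ (k, 0)"
    if "i \<le> m" "k \<le> n" for m n i k
    using that mult_transpose_column[OF mono[of m] Pc[of n], of i k] by (simp add: monomials_def)
  have int: "weighted_integrable \<Omega> \<rho> p" for p
  proof -
    \<comment> \<open>The entries of \<open>P\<^sub>n\<close> are integrable, being those of \<open>X\<^sub>0 P\<^sub>n\<^sup>t\<close>, and they span.\<close>
    have "bipoly_subspace {p. weighted_integrable \<Omega> \<rho> p}"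
      unfolding bipoly_subspace_def weighted_integrable_def
      by (auto simp: distrib_right mult.assoc intro: set_integral_add)
    then have "p \<in> {p. weighted_integrable \<Omega> \<rho> p}"
      by (rule polynomial_system_spans[OF P]) (use Pint[of 0 _ 0] entry[of 0 0] in auto)
    then show ?thesis by simp
  qed
  then have int': "set_integrable lebesgue \<Omega> (\<lambda>z. eval p z * \<rho> z)" for p
    by (simp add: weighted_integrable_def)
  have add: "v (p + q) = v p + v q" for p q
    using set_integral_add(2)[OF int'[of p] int'[of q]]
    by (simp add: v weighted_integral_def distrib_right)
  have scale: "v (const c * p) = c * v p" for c p
    by (simp add: v weighted_integral_def mult.assoc)
  have lin: "moment_functional v"
    unfolding moment_functional_def
    by unfold_locales (simp_all add: add scale const_add const_mult distrib_left distrib_right mult.assoc)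
  have ortho: "orthogonal_wrt_functional v P"
  proof (rule orthogonal_wrt_functional_of_monomials[OF P add scale])
    show "v (varx ^ (m - i) * vary ^ i * P n $$ (k, 0)) = 0" if "m < n" "i \<le> m" "k \<le> n" for m n i k
    proof -
      have "map_mat v (monomials m * transpose_mat (P n)) $$ (i, k) = 0"
        using orth[OF that(1)] that by (simp add: v_def)
      then show ?thesis using that mono[of m] Pc[of n] entry[OF that(2,3)] by simp
    qed
    show "invertible_mat (map_mat v (monomials n * transpose_mat (P n)))" for n
      using nondeg[of n] by (simp add: v_def)
  qed
  have nontrivial: "\<exists>z\<in>\<Omega>. \<rho> z \<noteq> 0"
  proof (rule ccontr)
    assume "\<not> ?thesis"
    then have "weighted_integral \<Omega> \<rho> p = 0" for p
      unfolding weighted_integral_def set_lebesgue_integral_def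
      by (intro integral_eq_zero_AE AE_I2) (auto simp: indicator_def)
    then have z: "map_mat (weighted_integral \<Omega> \<rho>) (monomials 0 * transpose_mat (P 0)) = 0\<^sub>m 1 1"
      using mono[of 0] Pc[of 0] by (intro eq_matI) auto
    obtain B where B: "0\<^sub>m 1 1 * B = (1\<^sub>m 1 :: real mat)" "B * 0\<^sub>m 1 1 = 1\<^sub>m (dim_row B)"
      using nondeg[of 0] unfolding z invertible_mat_def inverts_mat_def by auto
    have "B \<in> carrier_mat 1 1"
      using arg_cong[OF B(1), of dim_col] arg_cong[OF B(2), of dim_col] by (intro carrier_matI) auto
    then have "(0\<^sub>m 1 1 * B) $$ (0, 0) = 0" by simp
    moreover have "(0\<^sub>m 1 1 * B) $$ (0, 0) = 1" unfolding B(1) by simp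
    ultimately show False by simp
  qed
  interpret pearson_weight \<Omega> \<rho> "\<Phi> $$ (0, 0)" "\<Phi> $$ (0, 1)" "\<Phi> $$ (1, 1)" \<psi>\<^sub>1 \<psi>\<^sub>2
    by (rule pearson_weight_of_classical_weight[OF assms(1-4) int nontrivial])
  have \<Phi>: "\<Phi> \<in> carrier_mat 2 2" "transpose_mat \<Phi> = \<Phi>"
    using assms(4) by (auto simp: classical_weight_def)
  have sym: "\<Phi> $$ (1, 0) = \<Phi> $$ (0, 1)"
    using \<Phi> by (metis carrier_matD index_transpose_mat(1) one_less_numeral_iff pos2 semiring_norm(76))
  have w1: "v (\<psi>\<^sub>1 * p) = - v (\<Phi> $$ (0, 0) * dx p) - v (\<Phi> $$ (1, 0) * dy p)" for p
    using weak_pearson\<^sub>1[of p] add by (simp only: sym flip: weighted_integral_def v)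
  have w2: "v (\<psi>\<^sub>2 * p) = - v (\<Phi> $$ (0, 1) * dx p) - v (\<Phi> $$ (1, 1) * dy p)" for p
    using weak_pearson\<^sub>2[of p] add by (simp only: sym flip: weighted_integral_def v)
  have div: "div_functional \<Phi> v = mult_row_functional (row2 \<psi>\<^sub>1 \<psi>\<^sub>2) v"
  proof (rule eq_matI)
    fix i j assume "i < dim_row (mult_row_functional (row2 \<psi>\<^sub>1 \<psi>\<^sub>2) v)" "j < dim_col (mult_row_functional (row2 \<psi>\<^sub>1 \<psi>\<^sub>2) v)"
    then have ij: "i = 0" "j = 0 \<or> j = 1"
      by (auto simp: mult_row_functional_def row2_def mat_of_rows_list_def)
    then show "div_functional \<Phi> v $$ (i, j) = mult_row_functional (row2 \<psi>\<^sub>1 \<psi>\<^sub>2) v $$ (i, j)"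
      by (auto simp: div_functional_def mult_row_functional_def row2_def mat_of_rows_list_def
          mult_functional_def dx_functional_def dy_functional_def w1 w2)
  qed (simp_all add: div_functional_def mult_row_functional_def row2_def mat_of_rows_list_def)
  \<comment> \<open>The quadratic form of \<open>\<langle>v, \<Phi>\<rangle>\<close> is the weighted integral of the positive definite forms of \<open>\<Phi>\<close>.\<close>
  have "Determinant.det (map_mat v \<Phi>) \<noteq> 0"
  proof (rule det_nonzero_of_quadratic_form)
    show "map_mat v \<Phi> \<in> carrier_mat 2 2" using \<Phi>(1) by simp
    show "map_mat v \<Phi> $$ (1, 0) = map_mat v \<Phi> $$ (0, 1)" using \<Phi>(1) sym by simp
    fix s t :: real assume st: "s \<noteq> 0 \<or> t \<noteq> 0"
    let ?p = "const (s * s) * \<Phi> $$ (0, 0) + const (2 * (s * t)) * \<Phi> $$ (0, 1) + const (t * t) * \<Phi> $$ (1, 1)"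
    have "v ?p > 0"
      unfolding v weighted_integral_def
    proof (rule integral_pos_on_open)
      show "open \<Omega>" "\<Omega> \<noteq> {}" using assms(1) nontrivial by auto
      show "set_integrable lebesgue \<Omega> (\<lambda>z. eval ?p z * \<rho> z)" by (rule int')
      show "eval ?p z * \<rho> z > 0" if z: "z \<in> \<Omega>" for z
      proof (rule mult_pos_pos)
        have "positive_definite (eval_mat \<Phi> z)" using assms(4) z by (simp add: classical_weight_def)
        from quadratic_form_2[OF _ this _ st] show "eval ?p z > 0"
          using \<Phi>(1) sym by (simp add: eval_mat_def mult_ac)
      qed (rule \<rho>_pos[OF z])
    qed
    then show "map_mat v \<Phi> $$ (0, 0) * (s * s) + 2 * map_mat v \<Phi> $$ (0, 1) * (s * t) + map_mat v \<Phi> $$ (1, 1) * (t * t) > 0"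
      using \<Phi>(1) unfolding add scale by (simp add: mult_ac)
  qed
  with int lin ortho div show ?thesis by blast
qed

end
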